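(* Let $(\mathcal M,\varphi,\xi,\eta,g)$ be a connected almost para-contact metric manifold of dimension $2n+1$, and suppose that the Jacobi operator $J_\xi$ of the characteristic vector field $\xi$ has maximal rank (that is, rank $2n$) at every point of $\mathcal M$. Then there is no non-trivial parallel quadratic form on $\mathcal M$: if $\alpha$ is a symmetric $(0,2)$-tensor field on $\mathcal M$, not identically zero, with $\nabla\alpha=0$, then $\alpha=c\,g$ for some non-zero constant $c\in\mathbb R$. Moreover, $(\mathcal M,g)$ is locally irreducible.
   Context: All manifolds and tensor fields are smooth. An almost para-contact metric manifold (in the paper's wide sense, covering both almost contact metric and almost para-contact metric structures) is a $(2n+1)$-dimensional manifold $\mathcal M$ with a $(1,1)$-tensor field $\varphi$, a vector field $\xi$ (the characteristic vector field), a 1-form $\eta$ and a pseudo-Riemannian metric $g$ such that, for a fixed $\varepsilon\in\{-1,+1\}$, $$\varphi^2=\varepsilon(\mathrm{Id}-\eta\otimes\xi),\quad \eta(\xi)=1,\quad g(\varphi X,\varphi Y)=-\varepsilon\,(g(X,Y)-\eta(X)\eta(Y))$$ for all vector fields $X,Y$; when $\varepsilon=-1$ the metric $g$ is assumed positive definite. $\nabla$ is the Levi-Civita connection of $g$, and $R_{XY}Z=\nabla_X\nabla_YZ-\nabla_Y\nabla_XZ-\nabla_{[X,Y]}Z$. The Jacobi operator of a vector field $\xi$ is the $(1,1)$-tensor field $J_\xi:X\mapsto R_{X\xi}\xi$. Since $J_\xi\xi=0$, its rank at each point is at most $\dim\mathcal M-1$; it has maximal rank if its rank equals $\dim\mathcal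 M-1$. A parallel quadratic form is the form $X\mapsto\alpha(X,X)$ of a symmetric $(0,2)$-tensor field $\alpha$ with $\nabla\alpha=0$; it is identified with $\alpha$. A pseudo-Riemannian manifold is locally irreducible if no point has an open neighbourhood isometric to a product of two pseudo-Riemannian manifolds of positive dimension. *)

theory Defs
  imports "HOL-Analysis.Analysis"
begin

text \<open>\<open>Ck_on\<close> and \<open>smooth_on\<close> are meant for open sets, since they use full derivatives.\<close>

primrec Ck_on ::
  "nat \<Rightarrow> 'a::euclidean_space set \<Rightarrow> ('a \<Rightarrow> 'b::euclidean_space) \<Rightarrow> bool" where
  "Ck_on 0 S f \<longleftrightarrow> continuous_on S f"
| "Ck_on (Suc k) S f \<longleftrightarrow>
     f differentiable_on S \<and> (\<forall>v. Ck_on k S (\<lambda>x. frechet_derivative f (at x) v))"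

definition smooth_on ::
  "'a::euclidean_space set \<Rightarrow> ('a \<Rightarrow> 'b::euclidean_space) \<Rightarrow> bool" where
  "smooth_on S f \<longleftrightarrow> (\<forall>k. Ck_on k S f)"

text \<open>
  An atlas is an indexed family of charts: \<open>coord M i\<close> is the chart map, to be used on the
  chart domain \<open>chart_dom M i\<close> only.  The points of the manifold are those covered by some domain;
  its topology is the one of the type of points (and the set of points is open in it), and its
  dimension is that of the model space \<open>'b\<close>, which is always positive.
\<close>

record ('i, 'm, 'b) atlas =
  idx :: "'i set"
  chart_dom :: "'i \<Rightarrow> 'm set"
  coord :: "'i \<Rightarrow> 'm \<Rightarrow> 'b"

definition points :: "('i, 'm, 'b) atlas \<Rightarrow> 'm set" where
  "points M = (\<Union>i\<in>idx M. chart_dom M i)"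

definition chart_image :: "('i, 'm, 'b) atlas \<Rightarrow> 'i \<Rightarrow> 'b set" where
  "chart_image M i = coord M i ` chart_dom M i"

definition chart_inv :: "('i, 'm, 'b) atlas \<Rightarrow> 'i \<Rightarrow> 'b \<Rightarrow> 'm" where
  "chart_inv M i = inv_into (chart_dom M i) (coord M i)"

definition overlap :: "('i, 'm, 'b) atlas \<Rightarrow> 'i \<Rightarrow> 'i \<Rightarrow> 'b set" where
  "overlap M i j = coord M i ` (chart_dom M i \<inter> chart_dom M j)"

definition transition :: "('i, 'm, 'b) atlas \<Rightarrow> 'i \<Rightarrow> 'i \<Rightarrow> 'b \<Rightarrow> 'b" where
  "transition M i j = coord M j \<circ> chart_inv M i"

definition smooth_manifold ::
  "('i, 'm::{t2_space, second_countable_topology}, 'b::euclidean_space) atlas \<Rightarrow> bool" where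
  "smooth_manifold M \<longleftrightarrow>
     (\<forall>i\<in>idx M. open (chart_dom M i) \<and> open (chart_image M i) \<and>
        homeomorphism (chart_dom M i) (chart_image M i) (coord M i) (chart_inv M i)) \<and>
     (\<forall>i\<in>idx M. \<forall>j\<in>idx M. smooth_on (overlap M i j) (transition M i j))"

text \<open>
  A tensor field is given by its expressions in the charts, which are smooth and obey the
  transformation law of the respective type.  A vector at a point is, in the chart \<open>i\<close>, an
  element of the model space, and passing to the chart \<open>j\<close> it is transformed by the derivative of
  \<open>transition M i j\<close>.
\<close>

type_synonym ('i, 'b) vector_field = "'i \<Rightarrow> 'b \<Rightarrow> 'b"
type_synonym ('i, 'b) one_form = "'i \<Rightarrow> 'b \<Rightarrow> 'b \<Rightarrow> real"
type_synonym ('i, 'b) tensor11 = "'i \<Rightarrow> 'b \<Rightarrow> 'b \<Rightarrow> 'b"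
type_synonym ('i, 'b) tensor02 = "'i \<Rightarrow> 'b \<Rightarrow> 'b \<Rightarrow> 'b \<Rightarrow> real"

abbreviation dtransition ::
  "('i, 'm, 'b::euclidean_space) atlas \<Rightarrow> 'i \<Rightarrow> 'i \<Rightarrow> 'b \<Rightarrow> 'b \<Rightarrow> 'b" where
  "dtransition M i j x \<equiv> frechet_derivative (transition M i j) (at x)"

definition vector_field ::
  "('i, 'm, 'b::euclidean_space) atlas \<Rightarrow> ('i, 'b) vector_field \<Rightarrow> bool" where
  "vector_field M X \<longleftrightarrow>
     (\<forall>i\<in>idx M. smooth_on (chart_image M i) (X i)) \<and>
     (\<forall>i\<in>idx M. \<forall>j\<in>idx M. \<forall>x\<in>overlap M i j.
        X j (transition M i j x) = dtransition M i j x (X i x))"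

definition one_form ::
  "('i, 'm, 'b::euclidean_space) atlas \<Rightarrow> ('i, 'b) one_form \<Rightarrow> bool" where
  "one_form M \<omega> \<longleftrightarrow>
     (\<forall>i\<in>idx M. (\<forall>x\<in>chart_image M i. linear (\<omega> i x)) \<and>
        (\<forall>v. smooth_on (chart_image M i) (\<lambda>x. \<omega> i x v))) \<and>
     (\<forall>i\<in>idx M. \<forall>j\<in>idx M. \<forall>x\<in>overlap M i j. \<forall>v.
        \<omega> j (transition M i j x) (dtransition M i j x v) = \<omega> i x v)"

definition tensor11 ::
  "('i, 'm, 'b::euclidean_space) atlas \<Rightarrow> ('i, 'b) tensor11 \<Rightarrow> bool" where
  "tensor11 M A \<longleftrightarrow>
     (\<forall>i\<in>idx M. (\<forall>x\<in>chart_image M i. linear (A i x)) \<and>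
        (\<forall>v. smooth_on (chart_image M i) (\<lambda>x. A i x v))) \<and>
     (\<forall>i\<in>idx M. \<forall>j\<in>idx M. \<forall>x\<in>overlap M i j. \<forall>v.
        A j (transition M i j x) (dtransition M i j x v) = dtransition M i j x (A i x v))"

definition tensor02 ::
  "('i, 'm, 'b::euclidean_space) atlas \<Rightarrow> ('i, 'b) tensor02 \<Rightarrow> bool" where
  "tensor02 M a \<longleftrightarrow>
     (\<forall>i\<in>idx M. (\<forall>x\<in>chart_image M i. bilinear (a i x)) \<and>
        (\<forall>v w. smooth_on (chart_image M i) (\<lambda>x. a i x v w))) \<and>
     (\<forall>i\<in>idx M. \<forall>j\<in>idx M. \<forall>x\<in>overlap M i j. \<forall>v w.
        a j (transition M i j x) (dtransition M i j x v) (dtransition M i j x w) = a i x v w)"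

definition symmetric_tensor ::
  "('i, 'm, 'b::euclidean_space) atlas \<Rightarrow> ('i, 'b) tensor02 \<Rightarrow> bool" where
  "symmetric_tensor M a \<longleftrightarrow>
     tensor02 M a \<and> (\<forall>i\<in>idx M. \<forall>x\<in>chart_image M i. \<forall>v w. a i x v w = a i x w v)"

definition pseudo_riemannian_metric ::
  "('i, 'm, 'b::euclidean_space) atlas \<Rightarrow> ('i, 'b) tensor02 \<Rightarrow> bool" where
  "pseudo_riemannian_metric M g \<longleftrightarrow>
     symmetric_tensor M g \<and>
     (\<forall>i\<in>idx M. \<forall>x\<in>chart_image M i. \<forall>v. (\<forall>w. g i x v w = 0) \<longrightarrow> v = 0)"

definition positive_definite ::
  "('i, 'm, 'b::euclidean_space) atlas \<Rightarrow> ('i, 'b) tensor02 \<Rightarrow> bool" where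
  "positive_definite M g \<longleftrightarrow>
     (\<forall>i\<in>idx M. \<forall>x\<in>chart_image M i. \<forall>v. v \<noteq> 0 \<longrightarrow> g i x v v > 0)"

text \<open>
  Here \<open>g\<close> is the expression of a metric in one chart, and \<open>X\<close>, \<open>Y\<close>, \<open>Z\<close> are the expressions of
  vector fields defined on the domain of this chart.  The Levi-Civita connection is the connection
  which is torsion-free (symmetric Christoffel symbols) and compatible with the metric; see the
  lemma \<open>christoffel\<close> below for existence and uniqueness.
\<close>

type_synonym 'b local_metric = "'b \<Rightarrow> 'b \<Rightarrow> 'b \<Rightarrow> real"

definition is_christoffel ::
  "'b::euclidean_space local_metric \<Rightarrow> 'b \<Rightarrow> ('b \<Rightarrow> 'b \<Rightarrow> 'b) \<Rightarrow> bool" where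
  "is_christoffel g x \<Gamma> \<longleftrightarrow>
     bilinear \<Gamma> \<and> (\<forall>u v. \<Gamma> u v = \<Gamma> v u) \<and>
     (\<forall>u v w. frechet_derivative (\<lambda>y. g y v w) (at x) u = g x (\<Gamma> u v) w + g x v (\<Gamma> u w))"

definition christoffel :: "'b::euclidean_space local_metric \<Rightarrow> 'b \<Rightarrow> 'b \<Rightarrow> 'b \<Rightarrow> 'b" where
  "christoffel g x = (THE \<Gamma>. is_christoffel g x \<Gamma>)"

definition nabla ::
  "'b::euclidean_space local_metric \<Rightarrow> ('b \<Rightarrow> 'b) \<Rightarrow> ('b \<Rightarrow> 'b) \<Rightarrow> 'b \<Rightarrow> 'b" where
  "nabla g X Y = (\<lambda>x. frechet_derivative Y (at x) (X x) + christoffel g x (X x) (Y x))"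

definition lie_bracket ::
  "('b::euclidean_space \<Rightarrow> 'b) \<Rightarrow> ('b \<Rightarrow> 'b) \<Rightarrow> 'b \<Rightarrow> 'b" where
  "lie_bracket X Y =
     (\<lambda>x. frechet_derivative Y (at x) (X x) - frechet_derivative X (at x) (Y x))"

definition curvature ::
  "'b::euclidean_space local_metric \<Rightarrow> ('b \<Rightarrow> 'b) \<Rightarrow> ('b \<Rightarrow> 'b) \<Rightarrow> ('b \<Rightarrow> 'b) \<Rightarrow> 'b \<Rightarrow> 'b" where
  "curvature g X Y Z =
     (\<lambda>x. nabla g X (nabla g Y Z) x - nabla g Y (nabla g X Z) x - nabla g (lie_bracket X Y) Z x)"

definition jacobi_operator ::
  "'b::euclidean_space local_metric \<Rightarrow> ('b \<Rightarrow> 'b) \<Rightarrow> ('b \<Rightarrow> 'b) \<Rightarrow> 'b \<Rightarrow> 'b" where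
  "jacobi_operator g \<xi> X = curvature g X \<xi> \<xi>"

definition nabla_tensor02 ::
  "'b::euclidean_space local_metric \<Rightarrow> ('b \<Rightarrow> 'b \<Rightarrow> 'b \<Rightarrow> real) \<Rightarrow>
     ('b \<Rightarrow> 'b) \<Rightarrow> ('b \<Rightarrow> 'b) \<Rightarrow> ('b \<Rightarrow> 'b) \<Rightarrow> 'b \<Rightarrow> real" where
  "nabla_tensor02 g a X Y Z =
     (\<lambda>x. frechet_derivative (\<lambda>y. a y (Y y) (Z y)) (at x) (X x)
            - a x (nabla g X Y x) (Z x) - a x (Y x) (nabla g X Z x))"

lemma is_christoffel_unique:
  fixes g :: "'b::euclidean_space local_metric"
  assumes bil: "bilinear (g x)" and sym: "\<And>v w. g x v w = g x w v"
    and nondeg: "\<And>v. (\<forall>w. g x v w = 0) \<Longrightarrow> v = 0"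
    and \<Gamma>: "is_christoffel g x \<Gamma>" and \<Delta>: "is_christoffel g x \<Delta>"
  shows "\<Gamma> = \<Delta>"
proof (intro ext)
  fix u v
  have koszul: "2 * g x (G u v) w =
      frechet_derivative (\<lambda>y. g y v w) (at x) u + frechet_derivative (\<lambda>y. g y u w) (at x) v
      - frechet_derivative (\<lambda>y. g y u v) (at x) w" if "is_christoffel g x G" for G w
  proof -
    have D: "frechet_derivative (\<lambda>y. g y b c) (at x) a = g x (G a b) c + g x b (G a c)"
      and S: "G a b = G b a" for a b c
      using that unfolding is_christoffel_def by blast+
    show ?thesis
      using D[of v w u] D[of u w v] D[of u v w] S[of u v] S[of u w] S[of v w]
        sym[of v "G u w"] sym[of u "G v w"] by simp
  qed
  have "g x (\<Gamma> u v - \<Delta> u v) w = 0" for w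
    using koszul[OF \<Gamma>, of w] koszul[OF \<Delta>, of w] bilinear_lsub[OF bil] by simp
  then show "\<Gamma> u v = \<Delta> u v"
    using nondeg[of "\<Gamma> u v - \<Delta> u v"] by simp
qed

lemma christoffel:
  fixes g :: "'b::euclidean_space local_metric"
  assumes "open S" and x: "x \<in> S"
    and bil: "\<And>y. y \<in> S \<Longrightarrow> bilinear (g y)" and sym: "\<And>y v w. y \<in> S \<Longrightarrow> g y v w = g y w v"
    and nondeg: "\<And>v. (\<forall>w. g x v w = 0) \<Longrightarrow> v = 0"
    and diff: "\<And>v w. (\<lambda>y. g y v w) differentiable (at x)"
  shows "is_christoffel g x (christoffel g x)"
proof -
  define D where "D = (\<lambda>u v w. frechet_derivative (\<lambda>y. g y v w) (at x) u)"
  have hd: "((\<lambda>y. g y v w) has_derivative (\<lambda>u. D u v w)) (at x)" for v w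
    unfolding D_def using diff frechet_derivative_works by blast
  have uniq: "D u v w = E u"
    if "((\<lambda>y. f y) has_derivative E) (at x)" "\<And>y. y \<in> S \<Longrightarrow> g y v w = f y" for f E u v w
  proof -
    have "((\<lambda>y. g y v w) has_derivative E) (at x)"
      using has_derivative_transform_within_open[OF that(1) assms(1) x] that(2) by simp
    then show ?thesis using has_derivative_unique[OF hd] by metis
  qed
  have D_sym: "D u v w = D u w v" for u v w
    by (rule uniq[OF hd]) (rule sym)
  have D1: "linear (\<lambda>u. D u v w)" for v w
    using has_derivative_linear[OF hd] .
  have D3: "linear (\<lambda>w. D u v w)" for u v
  proof (rule linearI)
    show "D u v (b + c) = D u v b + D u v c" for b c
      by (rule uniq[OF has_derivative_add[OF hd hd]]) (simp add: bilinear_radd[OF bil])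
    show "D u v (r *\<^sub>R b) = r *\<^sub>R D u v b" for r b
      by (rule uniq[OF has_derivative_scaleR_right[OF hd]]) (simp add: bilinear_rmul[OF bil])
  qed
  have D2: "linear (\<lambda>v. D u v w)" for u w
    using D3[of u w] by (simp add: D_sym[of u _ w])
  define K where "K = (\<lambda>u v w. (D u v w + D v u w - D w u v) / 2)"
  define F where "F = (\<lambda>v. \<Sum>b\<in>Basis. g x v b *\<^sub>R b)"
  have lin_g: "linear (\<lambda>w. g x v w)" "linear (\<lambda>v. g x v w)" for v w
    using bil[OF x] by (auto simp: bilinear_def)
  have F_inner: "F v \<bullet> w = g x v w" for v w
  proof -
    have "g x v w = g x v (\<Sum>b\<in>Basis. (w \<bullet> b) *\<^sub>R b)" by (simp add: euclidean_representation)
    also have "\<dots> = (\<Sum>b\<in>Basis. (w \<bullet> b) * g x v b)"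
      by (simp add: linear_sum[OF lin_g(1)] linear_cmul[OF lin_g(1)])
    finally show ?thesis
      by (simp add: F_def inner_sum_left inner_sum_right inner_commute mult.commute)
  qed
  have "linear F"
    unfolding F_def
    by (intro linear_compose_sum ballI linearI)
      (simp_all add: linear_add[OF lin_g(2)] linear_cmul[OF lin_g(2)] scaleR_add_left)
  moreover have "inj F"
  proof (subst linear_injective_0[OF \<open>linear F\<close>], intro allI impI)
    fix v assume "F v = 0"
    then have "g x v w = 0" for w using F_inner[of v w] by simp
    then show "v = 0" using nondeg by blast
  qed
  ultimately have "surj F" by (rule linear_injective_imp_surjective) (rule refl)
  have "\<exists>z. \<forall>w. g x z w = K u v w" for u v
  proof -
    have lin_K: "linear (K u v)"
      unfolding K_def using D1[of u v] D3[of u v] D3[of v u]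
      by (auto simp: linear_iff algebra_simps add_divide_distrib diff_divide_distrib)
    obtain z where z: "F z = (\<Sum>b\<in>Basis. K u v b *\<^sub>R b)" using \<open>surj F\<close> by (metis surjD)
    have "g x z w = K u v w" for w
    proof -
      have "K u v w = K u v (\<Sum>b\<in>Basis. (w \<bullet> b) *\<^sub>R b)" by (simp add: euclidean_representation)
      also have "\<dots> = (\<Sum>b\<in>Basis. (w \<bullet> b) * K u v b)"
        by (simp add: linear_sum[OF lin_K] linear_cmul[OF lin_K])
      finally show ?thesis
        unfolding F_inner[symmetric] z
        by (simp add: inner_sum_left inner_sum_right inner_commute mult.commute)
    qed
    then show ?thesis by blast
  qed
  then obtain \<Gamma> where \<Gamma>: "\<And>u v w. g x (\<Gamma> u v) w = K u v w" by metis
  have eqI: "a = b" if "\<And>w. g x a w = g x b w" for a b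
    using nondeg[of "a - b"] that by (simp add: bilinear_lsub[OF bil[OF x]])
  have "is_christoffel g x \<Gamma>"
    unfolding is_christoffel_def
  proof (intro conjI allI)
    show sym_\<Gamma>: "\<Gamma> u v = \<Gamma> v u" for u v
      by (rule eqI) (simp add: \<Gamma> K_def D_sym[of _ u v])
    have lin: "linear (\<Gamma> u)" for u
    proof (rule linearI)
      show "\<Gamma> u (b + c) = \<Gamma> u b + \<Gamma> u c" for b c
        by (rule eqI)
          (simp add: \<Gamma> K_def linear_add[OF lin_g(2)] linear_add[OF D1] linear_add[OF D2]
            linear_add[OF D3] field_simps)
      show "\<Gamma> u (r *\<^sub>R b) = r *\<^sub>R \<Gamma> u b" for r b
        by (rule eqI)
          (simp add: \<Gamma> K_def linear_cmul[OF lin_g(2)] linear_cmul[OF D1] linear_cmul[OF D2]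
            linear_cmul[OF D3] field_simps)
    qed
    show "bilinear \<Gamma>"
      using lin sym_\<Gamma> by (simp add: bilinear_def)
    show "frechet_derivative (\<lambda>y. g y v w) (at x) u = g x (\<Gamma> u v) w + g x v (\<Gamma> u w)" for u v w
    proof -
      have "g x (\<Gamma> u v) w + g x v (\<Gamma> u w) = K u v w + K u w v"
        by (simp add: sym[OF x, of v] \<Gamma>)
      also have "\<dots> = D u v w"
        by (simp add: K_def D_sym[of w u v] D_sym[of v u w] D_sym[of u w v] field_simps)
      finally show ?thesis by (simp add: D_def)
    qed
  qed
  moreover have "G = \<Gamma>" if "is_christoffel g x G" for G
    using is_christoffel_unique[OF bil[OF x] sym[OF x] nondeg that \<open>is_christoffel g x \<Gamma>\<close>] by blast
  ultimately show ?thesis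
    unfolding christoffel_def by (rule theI)
qed

definition parallel ::
  "('i, 'm, 'b::euclidean_space) atlas \<Rightarrow> ('i, 'b) tensor02 \<Rightarrow> ('i, 'b) tensor02 \<Rightarrow> bool" where
  "parallel M g a \<longleftrightarrow>
     (\<forall>i\<in>idx M. \<forall>X Y Z.
        smooth_on (chart_image M i) X \<longrightarrow> smooth_on (chart_image M i) Y \<longrightarrow>
        smooth_on (chart_image M i) Z \<longrightarrow>
        (\<forall>x\<in>chart_image M i. nabla_tensor02 (g i) (a i) X Y Z x = 0))"

text \<open>
  The Jacobi operator is a (1,1)-tensor field, so its image at a point consists of the values at
  this point of the fields it produces from the vector fields on a chart domain; the rank is the
  dimension of this image.
\<close>

definition jacobi_rank ::
  "('i, 'm, 'b::euclidean_space) atlas \<Rightarrow> ('i, 'b) tensor02 \<Rightarrow> ('i, 'b) vector_field \<Rightarrow>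
     'i \<Rightarrow> 'b \<Rightarrow> nat" where
  "jacobi_rank M g \<xi> i x =
     dim ((\<lambda>X. jacobi_operator (g i) (\<xi> i) X x) ` {X. smooth_on (chart_image M i) X})"

definition almost_para_contact_metric ::
  "('i, 'm::{t2_space, second_countable_topology}, 'b::euclidean_space) atlas \<Rightarrow> real \<Rightarrow>
     ('i, 'b) tensor11 \<Rightarrow> ('i, 'b) vector_field \<Rightarrow> ('i, 'b) one_form \<Rightarrow> ('i, 'b) tensor02 \<Rightarrow>
     bool" where
  "almost_para_contact_metric M \<epsilon> \<phi> \<xi> \<eta> g \<longleftrightarrow>
     smooth_manifold M \<and> odd (DIM('b)) \<and> \<epsilon> \<in> {-1, 1} \<and>
     tensor11 M \<phi> \<and> vector_field M \<xi> \<and> one_form M \<eta> \<and> pseudo_riemannian_metric M g \<and>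
     (\<forall>i\<in>idx M. \<forall>x\<in>chart_image M i.
        (\<forall>v. \<phi> i x (\<phi> i x v) = \<epsilon> *\<^sub>R (v - \<eta> i x v *\<^sub>R \<xi> i x)) \<and>
        \<eta> i x (\<xi> i x) = 1 \<and>
        (\<forall>v w. g i x (\<phi> i x v) (\<phi> i x w) = - \<epsilon> * (g i x v w - \<eta> i x v * \<eta> i x w))) \<and>
     (\<epsilon> = -1 \<longrightarrow> positive_definite M g)"

definition open_submanifold :: "('i, 'm, 'b) atlas \<Rightarrow> 'm set \<Rightarrow> ('i, 'm, 'b) atlas" where
  "open_submanifold M U = M\<lparr>chart_dom := \<lambda>i. chart_dom M i \<inter> U\<rparr>"

definition product_manifold ::
  "('i, 'm, 'b) atlas \<Rightarrow> ('j, 'n, 'c) atlas \<Rightarrow> ('i \<times> 'j, 'm \<times> 'n, 'b \<times> 'c) atlas" where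
  "product_manifold M N =
     \<lparr>idx = idx M \<times> idx N,
      chart_dom = (\<lambda>(i, j). chart_dom M i \<times> chart_dom N j),
      coord = (\<lambda>(i, j). map_prod (coord M i) (coord N j))\<rparr>"

definition product_metric ::
  "('i, 'b) tensor02 \<Rightarrow> ('j, 'c) tensor02 \<Rightarrow> ('i \<times> 'j, 'b \<times> 'c) tensor02" where
  "product_metric g h =
     (\<lambda>(i, j) (x, y) (v, v') (w, w'). g i x v w + h j y v' w')"

definition chart_expr ::
  "('i, 'm, 'b) atlas \<Rightarrow> ('j, 'n, 'c) atlas \<Rightarrow> ('m \<Rightarrow> 'n) \<Rightarrow> 'i \<Rightarrow> 'j \<Rightarrow> 'b \<Rightarrow> 'c" where
  "chart_expr M N f i j = coord N j \<circ> f \<circ> chart_inv M i"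

definition chart_expr_dom ::
  "('i, 'm, 'b) atlas \<Rightarrow> ('j, 'n, 'c) atlas \<Rightarrow> ('m \<Rightarrow> 'n) \<Rightarrow> 'i \<Rightarrow> 'j \<Rightarrow> 'b set" where
  "chart_expr_dom M N f i j = coord M i ` (chart_dom M i \<inter> f -` chart_dom N j)"

definition smooth_map ::
  "('i, 'm::topological_space, 'b::euclidean_space) atlas \<Rightarrow>
     ('j, 'n::topological_space, 'c::euclidean_space) atlas \<Rightarrow> ('m \<Rightarrow> 'n) \<Rightarrow> bool" where
  "smooth_map M N f \<longleftrightarrow>
     f ` points M \<subseteq> points N \<and> continuous_on (points M) f \<and>
     (\<forall>i\<in>idx M. \<forall>j\<in>idx N. smooth_on (chart_expr_dom M N f i j) (chart_expr M N f i j))"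

definition isometry ::
  "('i, 'm::topological_space, 'b::euclidean_space) atlas \<Rightarrow> ('i, 'b) tensor02 \<Rightarrow>
     ('j, 'n::topological_space, 'c::euclidean_space) atlas \<Rightarrow> ('j, 'c) tensor02 \<Rightarrow>
     ('m \<Rightarrow> 'n) \<Rightarrow> bool" where
  "isometry M g N h f \<longleftrightarrow>
     bij_betw f (points M) (points N) \<and>
     smooth_map M N f \<and> smooth_map N M (inv_into (points M) f) \<and>
     (\<forall>i\<in>idx M. \<forall>j\<in>idx N. \<forall>x\<in>chart_expr_dom M N f i j. \<forall>v w.
        h j (chart_expr M N f i j x)
          (frechet_derivative (chart_expr M N f i j) (at x) v)
          (frechet_derivative (chart_expr M N f i j) (at x) w) = g i x v w)"

text \<open>
  Types cannot be quantified inside a formula, so the type of atlases of each of the two factors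
  (hence their dimensions) is a type argument.  Local irreducibility in the usual sense is the
  statement with these types left as type variables, that is, for all factor types.
\<close>

definition locally_irreducible ::
  "('j, 'n::{t2_space, second_countable_topology}, 'c::euclidean_space) atlas itself \<Rightarrow>
   ('k, 'p::{t2_space, second_countable_topology}, 'd::euclidean_space) atlas itself \<Rightarrow>
   ('i, 'm::{t2_space, second_countable_topology}, 'b::euclidean_space) atlas \<Rightarrow>
   ('i, 'b) tensor02 \<Rightarrow> bool" where
  "locally_irreducible _ _ M g \<longleftrightarrow>
     \<not> (\<exists>p\<in>points M. \<exists>U. open U \<and> p \<in> U \<and> U \<subseteq> points M \<and>
        (\<exists>(N1 :: ('j, 'n, 'c) atlas) h1 (N2 :: ('k, 'p, 'd) atlas) h2 f.
           smooth_manifold N1 \<and> pseudo_riemannian_metric N1 h1 \<and>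
           smooth_manifold N2 \<and> pseudo_riemannian_metric N2 h2 \<and>
           isometry (open_submanifold M U) g
             (product_manifold N1 N2) (product_metric h1 h2) f))"

end

theory Submission
  imports Defs
begin

text \<open>
  Write \<open>J X = R(X, \<xi>) \<xi>\<close> for the Jacobi operator.  The curvature is skew-symmetric with respect to
  every parallel symmetric form \<open>a\<close>, that is,
  \<open>a (R(X, Y) Z, W) + a (Z, R(X, Y) W) = 0\<close> (\<open>curvature_skew\<close>).  For \<open>a = g\<close> this shows that the image of
  \<open>J\<close> is orthogonal to \<open>\<xi>\<close>; as \<open>g (\<xi>, \<xi>) = 1\<close> (\<open>characteristic_field_unit\<close>), maximal rank means
  that it is the whole orthogonal complement of \<open>\<xi>\<close>.  For an arbitrary \<open>a\<close>, the choice
  \<open>Y = Z = W = \<xi>\<close> gives \<open>a (J X, \<xi>) = 0\<close>, so that \<open>a (\<xi>, v) = c g (\<xi>, v)\<close> for all \<open>v\<close>, where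
  \<open>c = a (\<xi>, \<xi>)\<close>, and the choice \<open>Y = Z = \<xi>\<close> then gives \<open>a (J X, W) = c g (J X, W)\<close>.  Hence \<open>a = c g\<close>
  at each point (\<open>parallel_form_proportional_at\<close>).  The factor \<open>c\<close> has derivative zero
  (\<open>proportionality_factor_derivative\<close>) and is independent of the chart, so it is constant on the
  connected manifold (\<open>parallel_tensor_proportional\<close>).

  The pointwise part of this argument is local.  If an open subset were isometric to a product, the
  metric of the first factor, pulled back along the projection, would be a parallel form there
  (\<open>parallel_form_pullback\<close>), hence a multiple of the metric.  But it is degenerate without being
  zero (\<open>pullback_not_proportional\<close>).

  The computations take place in charts.  Their two analytic ingredients are the symmetry of second derivatives (\<open>symmetric_second_derivative\<close>) and the
  differentiability of the Christoffel symbols (\<open>\<Gamma>_differentiable\<close>), without which the curvature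
  could not be computed by the Leibniz rule.
\<close>

section \<open>Second derivatives and families of multilinear maps\<close>

abbreviation dd :: "('a::euclidean_space \<Rightarrow> 'b::real_normed_vector) \<Rightarrow> 'a \<Rightarrow> 'a \<Rightarrow> 'b" where
  "dd f x \<equiv> frechet_derivative f (at x)"

text \<open>
  Second derivatives of functions that are twice differentiable, in this pointwise sense, are symmetric.
  The notion passes easily to functions such as \<open>a (Z, W)\<close> for a parallel form \<open>a\<close>, whose first
  derivatives are expressed through Christoffel symbols.
\<close>

definition twice_differentiable_on ::
  "('a::euclidean_space \<Rightarrow> 'b::real_normed_vector) \<Rightarrow> 'a set \<Rightarrow> bool" where
  "twice_differentiable_on f S \<longleftrightarrow>
     (\<forall>x\<in>S. f differentiable at x \<and> (\<forall>v. (\<lambda>y. dd f y v) differentiable at x))"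

lemma has_derivative_dd: "f differentiable at x \<Longrightarrow> (f has_derivative dd f x) (at x)"
  by (simp add: frechet_derivative_works)

lemma dd_eq: "(f has_derivative f') (at x) \<Longrightarrow> dd f x = f'"
  by (rule frechet_derivative_at[symmetric])

lemma linear_dd: "f differentiable at x \<Longrightarrow> linear (dd f x)"
  by (rule has_derivative_linear[OF has_derivative_dd])

lemma dd_transform:
  assumes "open S" "x \<in> S" "\<And>y. y \<in> S \<Longrightarrow> f y = g y"
  shows "dd f x = dd g x" and "f differentiable at x \<longleftrightarrow> g differentiable at x"
proof -
  have "(f has_derivative h) (at x) \<longleftrightarrow> (g has_derivative h) (at x)" for h
    using has_derivative_transform_within_open[OF _ assms(1,2), of f h UNIV g]
      has_derivative_transform_within_open[OF _ assms(1,2), of g h UNIV f] assms(3) by auto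
  then show "dd f x = dd g x" "f differentiable at x \<longleftrightarrow> g differentiable at x"
    unfolding frechet_derivative_def differentiable_def by auto
qed

lemma twice_differentiable_onD:
  assumes "twice_differentiable_on f S" "x \<in> S"
  shows "f differentiable at x" "(\<lambda>y. dd f y v) differentiable at x"
  using assms unfolding twice_differentiable_on_def by auto

lemma twice_differentiable_on_const: "twice_differentiable_on (\<lambda>_. c) S"
  unfolding twice_differentiable_on_def by (simp add: dd_eq[OF has_derivative_const])

text \<open>
  The mean value theorem in the direction \<open>u\<close> turns the second difference into \<open>t\<close> times a
  difference of values of \<open>q y = dd f y u\<close> at two points which are \<open>t v\<close> apart, and the first-order
  expansion of \<open>q\<close> at \<open>x\<close> evaluates that difference up to \<open>o(t)\<close>.
\<close>

lemma second_difference_estimate: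
  fixes f :: "'a::euclidean_space \<Rightarrow> real"
  assumes "open S" "x \<in> S" and f: "\<And>y. y \<in> S \<Longrightarrow> f differentiable at y"
    and q: "(\<lambda>y. dd f y u) differentiable at x" and "e > 0"
  shows "\<forall>\<^sub>F t in at_right 0.
    \<bar>f (x + t *\<^sub>R u + t *\<^sub>R v) - f (x + t *\<^sub>R u) - f (x + t *\<^sub>R v) + f x
       - t\<^sup>2 * dd (\<lambda>y. dd f y u) x v\<bar> \<le> e * t\<^sup>2"
proof -
  define q where "q = (\<lambda>y. dd f y u)"
  define A where "A = dd q x"
  have qA: "(q has_derivative A) (at x)"
    using q has_derivative_dd unfolding q_def A_def by blast
  have linA: "linear A" using qA has_derivative_linear by blast
  \<comment> \<open>All points involved lie within distance \<open>t * N\<close> of \<open>x\<close>.\<close>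
  define N where "N = 2 * norm u + norm v + 1"
  have N: "N > 0" unfolding N_def by (smt (verit) norm_ge_zero)
  \<comment> \<open>The expansion of \<open>q\<close> is used twice, with an error of at most \<open>e' * (t * N)\<close> each time.\<close>
  define e' where "e' = e / (2 * N)"
  have e': "e' > 0" using N \<open>e > 0\<close> unfolding e'_def by simp
  obtain d where d: "d > 0"
    and est: "\<And>y. norm (y - x) < d \<Longrightarrow> norm (q y - q x - A (y - x)) \<le> e' * norm (y - x)"
    using qA e' unfolding has_derivative_at_alt by blast
  obtain r where r: "r > 0" "ball x r \<subseteq> S"
    using assms(1,2) open_contains_ball by blast
  define \<delta> where "\<delta> = min d r / N"
  have \<delta>: "\<delta> > 0" using d r N unfolding \<delta>_def by simp
  have main: "\<bar>f (x + t *\<^sub>R u + t *\<^sub>R v) - f (x + t *\<^sub>R u) - f (x + t *\<^sub>R v) + f x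
       - t\<^sup>2 * A v\<bar> \<le> e * t\<^sup>2" if t: "0 < t" "t < \<delta>" for t
  proof -
    have tN: "t * N < min d r" using t N unfolding \<delta>_def by (simp add: pos_less_divide_eq)
    have near: "norm (s *\<^sub>R u + c *\<^sub>R v) \<le> t * N" if "0 \<le> s" "s \<le> t" "0 \<le> c" "c \<le> t" for s c
    proof -
      have "norm (s *\<^sub>R u + c *\<^sub>R v) \<le> s * norm u + c * norm v"
        using norm_triangle_ineq[of "s *\<^sub>R u" "c *\<^sub>R v"] that by simp
      also have "\<dots> \<le> t * norm u + t * norm v"
        using that by (intro add_mono mult_right_mono) auto
      also have "\<dots> \<le> t * N" using t unfolding N_def by (simp add: algebra_simps)
      finally show ?thesis .
    qed
    have inS: "x + s *\<^sub>R u + c *\<^sub>R v \<in> S" if "0 \<le> s" "s \<le> t" "0 \<le> c" "c \<le> t" for s c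
    proof -
      have "dist x (x + s *\<^sub>R u + c *\<^sub>R v) = norm (s *\<^sub>R u + c *\<^sub>R v)"
        by (subst dist_commute) (simp add: dist_norm add.assoc)
      then show ?thesis using near[OF that] tN r by auto
    qed
    have der: "((\<lambda>s. f (x + s *\<^sub>R u + c *\<^sub>R v)) has_derivative
        (\<lambda>h. h * q (x + s *\<^sub>R u + c *\<^sub>R v))) (at s within T)"
      if "0 \<le> s" "s \<le> t" "0 \<le> c" "c \<le> t" for s c T
    proof -
      let ?y = "x + s *\<^sub>R u + c *\<^sub>R v"
      have fd: "(f has_derivative dd f ?y) (at ?y)"
        using has_derivative_dd f inS[OF that] by blast
      have "((\<lambda>s. x + s *\<^sub>R u + c *\<^sub>R v) has_derivative (\<lambda>h. h *\<^sub>R u)) (at s within T)"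
        by (auto intro!: derivative_eq_intros)
      from has_derivative_compose[OF this fd]
      show ?thesis
        using linear_cmul[OF has_derivative_linear[OF fd]] by (simp add: q_def)
    qed
    have "((\<lambda>s. f (x + s *\<^sub>R u + t *\<^sub>R v) - f (x + s *\<^sub>R u + 0 *\<^sub>R v)) has_derivative
        (\<lambda>h. h * q (x + s *\<^sub>R u + t *\<^sub>R v) - h * q (x + s *\<^sub>R u + 0 *\<^sub>R v))) (at s within {0..t})"
      if "0 \<le> s" "s \<le> t" for s
      using t that by (intro has_derivative_diff der) auto
    from mvt_simple[OF t(1) this]
    obtain s where s: "0 < s" "s < t"
      and "(f (x + t *\<^sub>R u + t *\<^sub>R v) - f (x + t *\<^sub>R u + 0 *\<^sub>R v))
         - (f (x + 0 *\<^sub>R u + t *\<^sub>R v) - f (x + 0 *\<^sub>R u + 0 *\<^sub>R v))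
        = (t - 0) * q (x + s *\<^sub>R u + t *\<^sub>R v) - (t - 0) * q (x + s *\<^sub>R u + 0 *\<^sub>R v)"
      by auto
    then have eq: "f (x + t *\<^sub>R u + t *\<^sub>R v) - f (x + t *\<^sub>R u) - f (x + t *\<^sub>R v) + f x
        = t * (q (x + s *\<^sub>R u + t *\<^sub>R v) - q (x + s *\<^sub>R u))"
      by (simp add: right_diff_distrib)
    have e1: "norm (q (x + (s *\<^sub>R u + c *\<^sub>R v)) - q x - A (s *\<^sub>R u + c *\<^sub>R v)) \<le> e' * (t * N)"
      if "0 \<le> c" "c \<le> t" for c
    proof -
      have n: "norm (s *\<^sub>R u + c *\<^sub>R v) \<le> t * N" using near s that by simp
      then have "norm (x + (s *\<^sub>R u + c *\<^sub>R v) - x) < d" using tN by (simp del: norm_scaleR)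
      from est[OF this]
      have "norm (q (x + (s *\<^sub>R u + c *\<^sub>R v)) - q x - A (s *\<^sub>R u + c *\<^sub>R v))
          \<le> e' * norm (s *\<^sub>R u + c *\<^sub>R v)" by simp
      also have "\<dots> \<le> e' * (t * N)" using n e' by (intro mult_left_mono) auto
      finally show ?thesis .
    qed
    have A1: "A (s *\<^sub>R u + t *\<^sub>R v) = A (s *\<^sub>R u) + t * A v"
      using linA by (simp add: linear_add linear_cmul)
    have "\<bar>q (x + s *\<^sub>R u + t *\<^sub>R v) - q (x + s *\<^sub>R u) - t * A v\<bar> \<le> 2 * (e' * (t * N))"
      using e1[of t] e1[of 0] t A1 by (simp add: add.assoc abs_le_iff)
    also have "\<dots> = e * t" using N unfolding e'_def by (simp add: field_simps)
    finally have "t * \<bar>q (x + s *\<^sub>R u + t *\<^sub>R v) - q (x + s *\<^sub>R u) - t * A v\<bar> \<le> t * (e * t)"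
      using t by (intro mult_left_mono) auto
    moreover have "f (x + t *\<^sub>R u + t *\<^sub>R v) - f (x + t *\<^sub>R u) - f (x + t *\<^sub>R v) + f x - t\<^sup>2 * A v
       = t * (q (x + s *\<^sub>R u + t *\<^sub>R v) - q (x + s *\<^sub>R u) - t * A v)"
      unfolding eq by (simp add: right_diff_distrib power2_eq_square)
    ultimately show ?thesis
      using t by (simp only: abs_mult abs_of_pos power2_eq_square mult.left_commute)
  qed
  show ?thesis
    unfolding eventually_at_right_field
    using main \<delta> unfolding A_def q_def by blast
qed

text \<open>
  The second difference is symmetric in \<open>u\<close> and \<open>v\<close>, so by the preceding estimate both mixed
  derivatives are its limit after division by \<open>t\<^sup>2\<close>.
\<close>

lemma symmetric_second_derivative_real:
  fixes f :: "'a::euclidean_space \<Rightarrow> real"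
  assumes "open S" "x \<in> S" and f: "twice_differentiable_on f S"
  shows "dd (\<lambda>y. dd f y u) x v = dd (\<lambda>y. dd f y v) x u"
proof (rule ccontr)
  assume ne: "\<not> ?thesis"
  define a where "a = dd (\<lambda>y. dd f y u) x v"
  define b where "b = dd (\<lambda>y. dd f y v) x u"
  define e where "e = \<bar>a - b\<bar> / 3"
  have e: "e > 0" using ne unfolding e_def a_def b_def by simp
  have D: "\<And>y. y \<in> S \<Longrightarrow> f differentiable at y"
    and Q: "(\<lambda>y. dd f y w) differentiable at x" for w
    using f \<open>x \<in> S\<close> unfolding twice_differentiable_on_def by auto
  have est: "\<forall>\<^sub>F t in at_right 0.
      \<bar>f (x + t *\<^sub>R w + t *\<^sub>R z) - f (x + t *\<^sub>R w) - f (x + t *\<^sub>R z) + f x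
        - t\<^sup>2 * dd (\<lambda>y. dd f y w) x z\<bar> \<le> e * t\<^sup>2" for w z
    by (rule second_difference_estimate[OF assms(1,2) D Q e])
  have "\<forall>\<^sub>F t in at_right (0::real). \<bar>a - b\<bar> * t\<^sup>2 \<le> 2 * e * t\<^sup>2"
    using est[of u v] est[of v u]
  proof eventually_elim
    fix t :: real
    define \<Delta> where "\<Delta> = f (x + t *\<^sub>R u + t *\<^sub>R v) - f (x + t *\<^sub>R u) - f (x + t *\<^sub>R v) + f x"
    assume "\<bar>f (x + t *\<^sub>R u + t *\<^sub>R v) - f (x + t *\<^sub>R u) - f (x + t *\<^sub>R v) + f x
       - t\<^sup>2 * dd (\<lambda>y. dd f y u) x v\<bar> \<le> e * t\<^sup>2"
     "\<bar>f (x + t *\<^sub>R v + t *\<^sub>R u) - f (x + t *\<^sub>R v) - f (x + t *\<^sub>R u) + f x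
       - t\<^sup>2 * dd (\<lambda>y. dd f y v) x u\<bar> \<le> e * t\<^sup>2"
    then have "\<bar>\<Delta> - t\<^sup>2 * a\<bar> \<le> e * t\<^sup>2" "\<bar>\<Delta> - t\<^sup>2 * b\<bar> \<le> e * t\<^sup>2"
      unfolding \<Delta>_def a_def b_def by (simp_all add: algebra_simps)
    then have "\<bar>t\<^sup>2 * a - t\<^sup>2 * b\<bar> \<le> 2 * (e * t\<^sup>2)" by linarith
    moreover have "t\<^sup>2 * a - t\<^sup>2 * b = (a - b) * t\<^sup>2" by (simp add: algebra_simps)
    ultimately show "\<bar>a - b\<bar> * t\<^sup>2 \<le> 2 * e * t\<^sup>2" by (simp add: abs_mult)
  qed
  moreover have "\<forall>\<^sub>F t in at_right (0::real). t > 0"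
    by (simp add: eventually_at_right_less)
  ultimately have "\<forall>\<^sub>F t in at_right (0::real). False"
  proof eventually_elim
    fix t :: real assume "\<bar>a - b\<bar> * t\<^sup>2 \<le> 2 * e * t\<^sup>2" "0 < t"
    then have "\<bar>a - b\<bar> \<le> 2 * e" by simp
    then show False using e unfolding e_def by simp
  qed
  then show False by simp
qed

lemma symmetric_second_derivative:
  fixes f :: "'a::euclidean_space \<Rightarrow> 'b::euclidean_space"
  assumes "open S" "x \<in> S" and f: "twice_differentiable_on f S"
  shows "dd (\<lambda>y. dd f y u) x v = dd (\<lambda>y. dd f y v) x u"
proof (rule euclidean_eqI)
  fix b :: 'b
  have ip: "dd (\<lambda>y. h y \<bullet> b) y w = dd h y w \<bullet> b" "(\<lambda>y. h y \<bullet> b) differentiable at y"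
    if "h differentiable at y" for h :: "'a \<Rightarrow> 'b" and y w
  proof -
    have "((\<lambda>y. h y \<bullet> b) has_derivative (\<lambda>w. dd h y w \<bullet> b)) (at y)"
      by (rule has_derivative_inner_left[OF has_derivative_dd[OF that]])
    then show "dd (\<lambda>y. h y \<bullet> b) y w = dd h y w \<bullet> b" "(\<lambda>y. h y \<bullet> b) differentiable at y"
      by (auto simp: dd_eq differentiable_def)
  qed
  have D: "f differentiable at y" and Q: "(\<lambda>y. dd f y w) differentiable at y" if "y \<in> S" for w y
    using f that unfolding twice_differentiable_on_def by auto
  have dd2: "dd (\<lambda>y. dd (\<lambda>z. f z \<bullet> b) y w) y c = dd (\<lambda>y. dd f y w) y c \<bullet> b"
    and df2: "(\<lambda>y. dd (\<lambda>z. f z \<bullet> b) y w) differentiable at y" if "y \<in> S" for w y c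
    using dd_transform[OF \<open>open S\<close> that, of "\<lambda>y. dd (\<lambda>z. f z \<bullet> b) y w" "\<lambda>y. dd f y w \<bullet> b"]
      ip[OF D] ip[OF Q[OF that]] by auto
  have "twice_differentiable_on (\<lambda>z. f z \<bullet> b) S"
    unfolding twice_differentiable_on_def using ip D df2 by auto
  from symmetric_second_derivative_real[OF assms(1,2) this, of u v]
  show "dd (\<lambda>y. dd f y u) x v \<bullet> b = dd (\<lambda>y. dd f y v) x u \<bullet> b"
    using dd2[OF \<open>x \<in> S\<close>] by simp
qed

text \<open>
  The product rule for a field of linear maps applied to a field of vectors; expanding \<open>p\<close> in a basis
  reduces it to the rule for scalar multiples.
\<close>

lemma has_derivative_linear_family:
  fixes L :: "'a::euclidean_space \<Rightarrow> 'p::euclidean_space \<Rightarrow> 'q::real_normed_vector"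
  assumes "open S" "x \<in> S" and lin: "\<And>y. y \<in> S \<Longrightarrow> linear (L y)"
    and L: "\<And>v. (\<lambda>y. L y v) differentiable at x" and p: "(p has_derivative p') (at x)"
  shows "((\<lambda>y. L y (p y)) has_derivative (\<lambda>u. dd (\<lambda>y. L y (p x)) x u + L x (p' u))) (at x)"
proof -
  have expand: "L y v = (\<Sum>b\<in>Basis. (v \<bullet> b) *\<^sub>R L y b)" if "y \<in> S" for y v
  proof -
    have "L y v = L y (\<Sum>b\<in>Basis. (v \<bullet> b) *\<^sub>R b)" by (simp add: euclidean_representation)
    then show ?thesis
      by (simp add: linear_sum[OF lin[OF that]] linear_cmul[OF lin[OF that]])
  qed
  have dL: "((\<lambda>y. L y b) has_derivative dd (\<lambda>y. L y b) x) (at x)" for b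
    using has_derivative_dd L by blast
  have "((\<lambda>y. \<Sum>b\<in>Basis. (p x \<bullet> b) *\<^sub>R L y b) has_derivative
      (\<lambda>u. \<Sum>b\<in>Basis. (p x \<bullet> b) *\<^sub>R dd (\<lambda>y. L y b) x u)) (at x)"
    by (intro has_derivative_sum has_derivative_scaleR_right dL)
  then have "((\<lambda>y. L y (p x)) has_derivative
      (\<lambda>u. \<Sum>b\<in>Basis. (p x \<bullet> b) *\<^sub>R dd (\<lambda>y. L y b) x u)) (at x)"
    by (rule has_derivative_transform_within_open[OF _ assms(1,2)]) (simp add: expand[of _ "p x"])
  then have 1: "dd (\<lambda>y. L y (p x)) x = (\<lambda>u. \<Sum>b\<in>Basis. (p x \<bullet> b) *\<^sub>R dd (\<lambda>y. L y b) x u)"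
    by (rule dd_eq)
  have "((\<lambda>y. \<Sum>b\<in>Basis. (p y \<bullet> b) *\<^sub>R L y b) has_derivative
      (\<lambda>u. \<Sum>b\<in>Basis. (p x \<bullet> b) *\<^sub>R dd (\<lambda>y. L y b) x u + (p' u \<bullet> b) *\<^sub>R L x b)) (at x)"
    by (intro has_derivative_sum has_derivative_scaleR dL has_derivative_inner_left p)
  then have "((\<lambda>y. L y (p y)) has_derivative
      (\<lambda>u. \<Sum>b\<in>Basis. (p x \<bullet> b) *\<^sub>R dd (\<lambda>y. L y b) x u + (p' u \<bullet> b) *\<^sub>R L x b)) (at x)"
    by (rule has_derivative_transform_within_open[OF _ assms(1,2)]) (simp add: expand[of _ "p _"])
  then show ?thesis
    by (simp add: 1 sum.distrib expand[OF \<open>x \<in> S\<close>, of "p' _"])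
qed

lemma has_derivative_bilinear_family:
  fixes a :: "'a::euclidean_space \<Rightarrow> 'p::euclidean_space \<Rightarrow> 'r::euclidean_space \<Rightarrow> 'q::real_normed_vector"
  assumes "open S" "x \<in> S" and bil: "\<And>y. y \<in> S \<Longrightarrow> bilinear (a y)"
    and a: "\<And>v w. (\<lambda>y. a y v w) differentiable at x"
    and p: "(p has_derivative p') (at x)" and q: "(q has_derivative q') (at x)"
  shows "((\<lambda>y. a y (p y) (q y)) has_derivative
    (\<lambda>u. dd (\<lambda>y. a y (p x) (q x)) x u + a x (p' u) (q x) + a x (p x) (q' u))) (at x)"
proof -
  have lin: "linear (\<lambda>w. a y v w)" "linear (\<lambda>v. a y v w)" if "y \<in> S" for y v w
    using bil[OF that] by (auto simp: bilinear_def)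
  have 1: "((\<lambda>y. a y v (q y)) has_derivative
      (\<lambda>u. dd (\<lambda>y. a y v (q x)) x u + a x v (q' u))) (at x)" for v
    by (rule has_derivative_linear_family[OF assms(1,2) lin(1) a q])
  have "((\<lambda>y. a y (p y) (q y)) has_derivative
      (\<lambda>u. dd (\<lambda>y. a y (p x) (q y)) x u + a x (p' u) (q x))) (at x)"
    by (rule has_derivative_linear_family[where L = "\<lambda>y v. a y v (q y)", OF assms(1,2) lin(2) _ p])
      (use 1 in \<open>auto simp: differentiable_def\<close>)
  then show ?thesis by (simp add: dd_eq[OF 1] algebra_simps)
qed

text \<open>
  In \<open>X Y f - Y X f\<close> the second derivatives of \<open>f\<close> cancel by symmetry.
\<close>

lemma lie_bracket_commutator:
  fixes f :: "'a::euclidean_space \<Rightarrow> 'b::euclidean_space"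
  assumes "open S" "x \<in> S" and f: "twice_differentiable_on f S"
    and X: "X differentiable at x" and Y: "Y differentiable at x"
  shows "dd (\<lambda>y. dd f y (Y y)) x (X x) - dd (\<lambda>y. dd f y (X y)) x (Y x) = dd f x (lie_bracket X Y x)"
proof -
  have D: "\<And>y. y \<in> S \<Longrightarrow> linear (dd f y)" and Q: "(\<lambda>y. dd f y w) differentiable at x" for w
    using f \<open>x \<in> S\<close> linear_dd unfolding twice_differentiable_on_def by auto
  have "dd (\<lambda>y. dd f y (Z y)) x = (\<lambda>u. dd (\<lambda>y. dd f y (Z x)) x u + dd f x (dd Z x u))"
    if "Z differentiable at x" for Z
    by (rule dd_eq, rule has_derivative_linear_family[OF assms(1,2) D Q has_derivative_dd[OF that]])
  note this[OF X] this[OF Y]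
  then show ?thesis
    using symmetric_second_derivative[OF assms(1-3), of "Y x" "X x"]
    unfolding lie_bracket_def by (simp add: linear_diff[OF D[OF \<open>x \<in> S\<close>]])
qed

text \<open>
  Where one factor vanishes, continuity of the other factor suffices for the product to be
  differentiable.  This is how continuity of the solution of a linear system is upgraded to
  differentiability in \<open>differentiable_if_pairings\<close>.
\<close>

lemma has_derivative_mult_vanishing:
  fixes e s :: "'a::euclidean_space \<Rightarrow> real"
  assumes e: "(e has_derivative e') (at x)" and "e x = 0" and s: "isCont s x"
  shows "((\<lambda>y. s y * e y) has_derivative (\<lambda>u. s x * e' u)) (at x)"
proof -
  obtain K where K: "K \<ge> 0" "\<And>h. \<bar>e' h\<bar> \<le> norm h * K"
    using bounded_linear.nonneg_bounded[OF has_derivative_bounded_linear[OF e]] by auto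
  obtain d where d: "d > 0" "\<And>y. norm (y - x) < d \<Longrightarrow> \<bar>e y - e x - e' (y - x)\<bar> \<le> 1 * norm (y - x)"
    using e zero_less_one unfolding has_derivative_at_alt real_norm_def by metis
  have e_le: "\<bar>e y\<bar> \<le> (1 + K) * norm (y - x)" if "norm (y - x) < d" for y
    using d(2)[OF that] K(2)[of "y - x"] \<open>e x = 0\<close> by (simp add: algebra_simps)
  have "((\<lambda>y. (s y - s x) * e y) has_derivative (\<lambda>u. 0)) (at x)"
    unfolding has_derivative_at_alt
  proof (intro conjI allI impI)
    show "bounded_linear (\<lambda>u. 0)" by simp
    fix r :: real assume "r > 0"
    then have "r / (1 + K) > 0" using K by simp
    then obtain d' where d': "d' > 0" "\<And>y. norm (y - x) < d' \<Longrightarrow> \<bar>s y - s x\<bar> < r / (1 + K)"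
      using s unfolding continuous_at_eps_delta dist_norm by (metis real_norm_def)
    have "\<bar>(s y - s x) * e y\<bar> \<le> r * norm (y - x)" if "norm (y - x) < min d d'" for y
    proof -
      have "\<bar>s y - s x\<bar> * \<bar>e y\<bar> \<le> r / (1 + K) * ((1 + K) * norm (y - x))"
        using that d'(2)[of y] e_le[of y] K \<open>r > 0\<close> by (intro mult_mono) auto
      then show ?thesis using K by (simp add: abs_mult)
    qed
    then show "\<exists>d>0. \<forall>y. norm (y - x) < d \<longrightarrow>
        norm ((s y - s x) * e y - (s x - s x) * e x - 0) \<le> r * norm (y - x)"
      using d(1) d'(1) by (intro exI[of _ "min d d'"]) auto
  qed
  from has_derivative_add[OF this has_derivative_mult_right[OF e, of "s x"]]
  show ?thesis by (simp add: algebra_simps)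
qed

lemma twice_differentiable_on_bounded_linear:
  fixes f :: "'a::euclidean_space \<Rightarrow> 'b::real_normed_vector"
  assumes L: "bounded_linear L" and S: "open S" and f: "twice_differentiable_on f S"
  shows "twice_differentiable_on (\<lambda>x. L (f x)) S"
    and "x \<in> S \<Longrightarrow> dd (\<lambda>x. L (f x)) x v = L (dd f x v)"
proof -
  have L1: "((\<lambda>x. L (h x)) has_derivative (\<lambda>v. L (dd h x v))) (at x)"
    if "h differentiable at x" for h :: "'a \<Rightarrow> 'b" and x
    by (rule bounded_linear.has_derivative[OF L has_derivative_dd[OF that]])
  have L2: "dd (\<lambda>x. L (f x)) x v = L (dd f x v)" if "x \<in> S" for x v
    using dd_eq[OF L1[OF twice_differentiable_onD(1)[OF f that]]] by simp
  show "x \<in> S \<Longrightarrow> dd (\<lambda>x. L (f x)) x v = L (dd f x v)" by (rule L2)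
  have "(\<lambda>y. dd (\<lambda>x. L (f x)) y v) differentiable at x" if "x \<in> S" for x v
    using dd_transform(2)[OF S that, of "\<lambda>y. dd (\<lambda>x. L (f x)) y v" "\<lambda>y. L (dd f y v)"] L2
      L1[OF twice_differentiable_onD(2)[OF f that]] unfolding differentiable_def by blast
  then show "twice_differentiable_on (\<lambda>x. L (f x)) S"
    using L1[OF twice_differentiable_onD(1)[OF f]]
    unfolding twice_differentiable_on_def differentiable_def by blast
qed

lemma surj_derivative_if_right_inverse:
  fixes F :: "'a::euclidean_space \<Rightarrow> 'b::euclidean_space" and G :: "'b \<Rightarrow> 'a"
  assumes G: "G differentiable at z" and F: "F differentiable at (G z)"
    and "open S" "z \<in> S" "\<And>y. y \<in> S \<Longrightarrow> F (G y) = y"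
  shows "surj (dd F (G z))"
proof -
  have "((\<lambda>y. F (G y)) has_derivative (\<lambda>u. dd F (G z) (dd G z u))) (at z)"
    by (rule has_derivative_compose[OF has_derivative_dd[OF G] has_derivative_dd[OF F]])
  then have "((\<lambda>y. y) has_derivative (\<lambda>u. dd F (G z) (dd G z u))) (at z)"
    by (rule has_derivative_transform_within_open[OF _ assms(3,4)]) (rule assms(5))
  then have "(\<lambda>u. dd F (G z) (dd G z u)) = (\<lambda>u. u)"
    using has_derivative_unique[OF _ has_derivative_ident] by blast
  from fun_cong[OF this] show ?thesis by (rule surjI)
qed

section \<open>The Levi-Civita connection on an open set\<close>

text \<open>
  The expression of a pseudo-Riemannian metric on an open part of a chart.  Working on arbitrary open
  sets, and not on whole charts only, makes the results apply to the neighbourhood on which a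
  splitting of the manifold is given.
\<close>

locale metric_on =
  fixes V :: "'b::euclidean_space set" and g :: "'b local_metric"
  assumes open_V: "open V"
    and g_bilinear: "y \<in> V \<Longrightarrow> bilinear (g y)"
    and g_sym: "y \<in> V \<Longrightarrow> g y v w = g y w v"
    and g_nondeg: "y \<in> V \<Longrightarrow> (\<And>w. g y v w = 0) \<Longrightarrow> v = 0"
    and g_twice: "twice_differentiable_on (\<lambda>y. g y v w) V"
begin

lemma g_representation:
  assumes "x \<in> V"
  shows "\<exists>w. \<forall>v. g x v w = v \<bullet> b"
proof -
  note lin = g_bilinear[OF assms, unfolded bilinear_def]
  define F where "F = (\<lambda>w. \<Sum>b\<in>Basis. g x b w *\<^sub>R b)"
  have F: "v \<bullet> F w = g x v w" for v w
  proof -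
    have l: "linear (\<lambda>v. g x v w)" using lin by blast
    have "g x v w = g x (\<Sum>b\<in>Basis. (v \<bullet> b) *\<^sub>R b) w" by (simp add: euclidean_representation)
    also have "\<dots> = (\<Sum>b\<in>Basis. (v \<bullet> b) * g x b w)"
      by (simp add: linear_sum[OF l] linear_cmul[OF l])
    finally show ?thesis by (simp add: F_def inner_sum_right mult.commute)
  qed
  have "linear F"
    unfolding F_def using lin
    by (intro linear_compose_sum ballI linearI) (auto simp: linear_add linear_cmul scaleR_add_left)
  moreover have "inj F"
  proof (subst linear_injective_0[OF \<open>linear F\<close>], intro allI impI)
    fix w assume "F w = 0"
    then have "g x w v = 0" for v using F[of v w] g_sym[OF assms] by simp
    then show "w = 0" using g_nondeg[OF assms] by blast
  qed
  ultimately have "surj F" by (rule linear_injective_imp_surjective) (rule refl)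
  then obtain w where "F w = b" by (metis surjD)
  then show ?thesis using F by metis
qed

text \<open>
  The solution \<open>z\<close> of the linear system \<open>g y (z y) w = k w y\<close> is differentiable when the data \<open>k\<close> are.
  Choose the vectors \<open>w b\<close> that are \<open>g x\<close>-dual to the basis, so that the matrix of the system is the
  identity plus an error \<open>e\<close> vanishing at \<open>x\<close>.  For small \<open>e\<close> the solution is bounded, hence
  \<open>e z\<close> tends to \<open>0\<close> and \<open>z\<close> is continuous at \<open>x\<close>; then \<open>e z\<close> is differentiable at \<open>x\<close>, and so is
  \<open>z = k - e z\<close>.
\<close>

lemma differentiable_if_pairings:
  assumes "x \<in> V" and z: "\<And>w. (\<lambda>y. g y (z y) w) differentiable at x"
  shows "z differentiable at x"
proof -
  obtain w where w: "\<And>b v. g x v (w b) = v \<bullet> b"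
    using g_representation[OF assms(1)] by metis
  define e where "e = (\<lambda>b c y. g y c (w b) - c \<bullet> b)"
  define k where "k = (\<lambda>b y. g y (z y) (w b))"
  have k_eq: "k b y = z y \<bullet> b + (\<Sum>c\<in>Basis. (z y \<bullet> c) * e b c y)" if "y \<in> V" for b y
  proof -
    have l: "linear (\<lambda>v. g y v (w b))" using g_bilinear[OF that] by (simp add: bilinear_def)
    have "k b y = g y (\<Sum>c\<in>Basis. (z y \<bullet> c) *\<^sub>R c) (w b)"
      by (simp add: euclidean_representation k_def)
    also have "\<dots> = (\<Sum>c\<in>Basis. (z y \<bullet> c) * (c \<bullet> b + e b c y))"
      by (simp add: linear_sum[OF l] linear_cmul[OF l] e_def)
    also have "\<dots> = (\<Sum>c\<in>Basis. (z y \<bullet> c) * (c \<bullet> b)) + (\<Sum>c\<in>Basis. (z y \<bullet> c) * e b c y)"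
      by (simp add: algebra_simps sum.distrib)
    also have "(\<Sum>c\<in>Basis. (z y \<bullet> c) * (c \<bullet> b)) = z y \<bullet> b"
      using euclidean_inner[of "z y" b] by (simp add: inner_commute)
    finally show ?thesis .
  qed
  have e_diff: "e b c differentiable at x" and e_x: "e b c x = 0" for b c
    using g_twice[of c "w b"] assms(1) w
    unfolding e_def twice_differentiable_on_def by auto
  have k_diff: "k b differentiable at x" for b
    using z unfolding k_def .
  have near: "\<forall>\<^sub>F y in at x. y \<in> V"
    using open_V assms(1) eventually_at_in_open' by blast
  have e_lim: "(e b c \<longlongrightarrow> 0) (at x)" for b c
    using differentiable_imp_continuous_within[OF e_diff, of b c]
    unfolding continuous_within e_x .
  have k_lim: "(k b \<longlongrightarrow> k b x) (at x)" for b
    using differentiable_imp_continuous_within[OF k_diff, of b] unfolding continuous_within .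
  define m where "m = (\<lambda>y. \<Sum>b\<in>Basis. \<Sum>c\<in>Basis. \<bar>e b c y\<bar>)"
  have m_lim: "(m \<longlongrightarrow> 0) (at x)"
    unfolding m_def by (intro tendsto_null_sum tendsto_rabs_zero e_lim)
  define K where "K = (\<Sum>b\<in>Basis. \<bar>k b x\<bar>) + 1"
  have "((\<lambda>y. \<Sum>b\<in>Basis. \<bar>k b y\<bar>) \<longlongrightarrow> (\<Sum>b\<in>Basis. \<bar>k b x\<bar>)) (at x)"
    by (intro tendsto_sum tendsto_rabs k_lim)
  then have k_bd: "\<forall>\<^sub>F y in at x. (\<Sum>b\<in>Basis. \<bar>k b y\<bar>) < K"
    by (rule order_tendstoD) (simp add: K_def)
  have m_bd: "\<forall>\<^sub>F y in at x. m y < 1 / 2"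
    by (rule order_tendstoD[OF m_lim]) simp
  have bounded: "\<forall>\<^sub>F y in at x. norm (z y) \<le> 2 * K"
    using near k_bd m_bd
  proof eventually_elim
    fix y assume y: "y \<in> V" "(\<Sum>b\<in>Basis. \<bar>k b y\<bar>) < K" "m y < 1 / 2"
    have "\<bar>z y \<bullet> b\<bar> \<le> \<bar>k b y\<bar> + norm (z y) * (\<Sum>c\<in>Basis. \<bar>e b c y\<bar>)" for b
    proof -
      have "\<bar>\<Sum>c\<in>Basis. (z y \<bullet> c) * e b c y\<bar> \<le> (\<Sum>c\<in>Basis. norm (z y) * \<bar>e b c y\<bar>)"
        by (rule order_trans[OF sum_abs])
          (auto simp: abs_mult intro!: sum_mono mult_right_mono Basis_le_norm)
      then show ?thesis
        using k_eq[OF y(1), of b] by (simp add: sum_distrib_left)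
    qed
    then have "(\<Sum>b\<in>Basis. \<bar>z y \<bullet> b\<bar>)
        \<le> (\<Sum>b\<in>Basis. \<bar>k b y\<bar> + norm (z y) * (\<Sum>c\<in>Basis. \<bar>e b c y\<bar>))"
      by (intro sum_mono)
    also have "\<dots> = (\<Sum>b\<in>Basis. \<bar>k b y\<bar>) + norm (z y) * m y"
      by (simp add: sum.distrib m_def sum_distrib_left)
    finally have "norm (z y) \<le> K + norm (z y) * m y"
      using norm_le_l1[of "z y"] y(2) by linarith
    moreover have "norm (z y) * m y \<le> norm (z y) * (1 / 2)"
      using y(3) by (intro mult_left_mono) auto
    ultimately show "norm (z y) \<le> 2 * K" by simp
  qed
  have z_cont: "isCont (\<lambda>y. z y \<bullet> b) x" for b
  proof -
    have "((\<lambda>y. (z y \<bullet> c) * e b c y) \<longlongrightarrow> 0) (at x)" if "c \<in> Basis" for c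
    proof (rule Lim_null_comparison)
      show "\<forall>\<^sub>F y in at x. norm ((z y \<bullet> c) * e b c y) \<le> 2 * K * \<bar>e b c y\<bar>"
        using bounded
        by eventually_elim
          (auto simp: abs_mult intro!: mult_right_mono order_trans[OF Basis_le_norm[OF that]])
      show "((\<lambda>y. 2 * K * \<bar>e b c y\<bar>) \<longlongrightarrow> 0) (at x)"
        by (intro tendsto_mult_right_zero tendsto_rabs_zero e_lim)
    qed
    then have "((\<lambda>y. \<Sum>c\<in>Basis. (z y \<bullet> c) * e b c y) \<longlongrightarrow> 0) (at x)"
      by (intro tendsto_null_sum)
    from tendsto_diff[OF k_lim[of b] this]
    have "((\<lambda>y. k b y - (\<Sum>c\<in>Basis. (z y \<bullet> c) * e b c y)) \<longlongrightarrow> z x \<bullet> b) (at x)"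
      using k_eq[OF assms(1), of b] e_x by simp
    then show ?thesis
      unfolding isCont_def
      by (rule Lim_transform_eventually) (use near in eventually_elim, simp add: k_eq)
  qed
  have "(\<lambda>y. z y \<bullet> b) differentiable at x" for b
  proof -
    have "(\<lambda>y. (z y \<bullet> c) * e b c y) differentiable at x" for c
      using has_derivative_mult_vanishing[OF has_derivative_dd[OF e_diff] e_x z_cont]
      unfolding differentiable_def by blast
    then have "(\<lambda>y. k b y - (\<Sum>c\<in>Basis. (z y \<bullet> c) * e b c y)) differentiable at x"
      by (intro differentiable_diff k_diff differentiable_sum) auto
    then show ?thesis
      using dd_transform(2)[OF open_V assms(1), of "\<lambda>y. k b y - (\<Sum>c\<in>Basis. (z y \<bullet> c) * e b c y)"
          "\<lambda>y. z y \<bullet> b"] k_eq by simp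
  qed
  then show ?thesis
    using differentiable_componentwise_within[of z x UNIV] by simp
qed

abbreviation "\<Gamma> \<equiv> christoffel g"

lemma is_christoffel_\<Gamma>: "y \<in> V \<Longrightarrow> is_christoffel g y (\<Gamma> y)"
  using g_twice unfolding twice_differentiable_on_def
  by (intro christoffel[OF open_V] g_bilinear g_sym g_nondeg) auto

lemma \<Gamma>_bilinear: "y \<in> V \<Longrightarrow> bilinear (\<Gamma> y)"
  and \<Gamma>_sym: "y \<in> V \<Longrightarrow> \<Gamma> y u v = \<Gamma> y v u"
  and dd_g: "y \<in> V \<Longrightarrow> dd (\<lambda>z. g z v w) y u = g y (\<Gamma> y u v) w + g y v (\<Gamma> y u w)"
  using is_christoffel_\<Gamma> unfolding is_christoffel_def by blast+

lemma koszul: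
  assumes "y \<in> V"
  shows "g y (\<Gamma> y u v) w =
    (dd (\<lambda>z. g z v w) y u + dd (\<lambda>z. g z u w) y v - dd (\<lambda>z. g z u v) y w) / 2"
  using dd_g[OF assms, of v w u] dd_g[OF assms, of u w v] dd_g[OF assms, of u v w]
    \<Gamma>_sym[OF assms, of u v] \<Gamma>_sym[OF assms, of u w] \<Gamma>_sym[OF assms, of v w]
    g_sym[OF assms, of v "\<Gamma> y u w"] g_sym[OF assms, of u "\<Gamma> y v w"] by simp

text \<open>
  By the Koszul formula the pairings of \<open>\<Gamma> y u v\<close> with constant vectors are combinations of first
  derivatives of the metric.
\<close>

lemma \<Gamma>_differentiable:
  assumes "x \<in> V"
  shows "(\<lambda>y. \<Gamma> y u v) differentiable at x"
proof (rule differentiable_if_pairings[OF assms])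
  fix w
  have "(\<lambda>y. (dd (\<lambda>z. g z v w) y u + dd (\<lambda>z. g z u w) y v - dd (\<lambda>z. g z u v) y w) / 2)
      differentiable at x"
    using g_twice assms unfolding twice_differentiable_on_def
    by (intro differentiable_divide differentiable_diff differentiable_add) auto
  then show "(\<lambda>y. g y (\<Gamma> y u v) w) differentiable at x"
    by (subst dd_transform(2)[OF open_V assms koszul])
qed

lemma \<Gamma>_eqI: "y \<in> V \<Longrightarrow> is_christoffel g y G \<Longrightarrow> \<Gamma> y = G"
  using is_christoffel_unique[of g y "\<Gamma> y" G] is_christoffel_\<Gamma>[of y] g_bilinear g_sym g_nondeg
  by blast

section \<open>Parallel forms and the curvature\<close>

text \<open>
  Parallelism expressed through constant vector fields, for which \<open>nabla\<close> reduces to the Christoffel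
  symbols.
\<close>

definition parallel_form :: "('b \<Rightarrow> 'b \<Rightarrow> 'b \<Rightarrow> real) \<Rightarrow> bool" where
  "parallel_form a \<longleftrightarrow> (\<forall>y\<in>V. bilinear (a y) \<and> (\<forall>v w. a y v w = a y w v) \<and>
     (\<forall>v w. (\<lambda>z. a z v w) differentiable at y) \<and>
     (\<forall>u v w. dd (\<lambda>z. a z v w) y u = a y (\<Gamma> y u v) w + a y v (\<Gamma> y u w)))"

lemma parallel_formD:
  assumes "parallel_form a" "y \<in> V"
  shows "bilinear (a y)" "a y v w = a y w v" "(\<lambda>z. a z v w) differentiable at y"
    "dd (\<lambda>z. a z v w) y u = a y (\<Gamma> y u v) w + a y v (\<Gamma> y u w)"
  using assms unfolding parallel_form_def by blast+

lemma parallel_form_metric: "parallel_form g"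
  using g_bilinear g_sym dd_g g_twice
  unfolding parallel_form_def twice_differentiable_on_def by auto

lemma parallel_form_leibniz:
  assumes a: "parallel_form a" and "x \<in> V"
    and Y: "Y differentiable at x" and Z: "Z differentiable at x"
  shows "(\<lambda>y. a y (Y y) (Z y)) differentiable at x"
    and "dd (\<lambda>y. a y (Y y) (Z y)) x (X x) = a x (nabla g X Y x) (Z x) + a x (Y x) (nabla g X Z x)"
proof -
  have D: "((\<lambda>y. a y (Y y) (Z y)) has_derivative
      (\<lambda>u. dd (\<lambda>y. a y (Y x) (Z x)) x u + a x (dd Y x u) (Z x) + a x (Y x) (dd Z x u))) (at x)"
    by (rule has_derivative_bilinear_family[where a = a, OF open_V \<open>x \<in> V\<close> parallel_formD(1)[OF a]
      parallel_formD(3)[OF a \<open>x \<in> V\<close>] has_derivative_dd[OF Y] has_derivative_dd[OF Z]])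
  show "(\<lambda>y. a y (Y y) (Z y)) differentiable at x"
    using D unfolding differentiable_def by blast
  show "dd (\<lambda>y. a y (Y y) (Z y)) x (X x) = a x (nabla g X Y x) (Z x) + a x (Y x) (nabla g X Z x)"
    using parallel_formD(1)[OF a \<open>x \<in> V\<close>] parallel_formD(4)[OF a \<open>x \<in> V\<close>]
    by (simp add: dd_eq[OF D] nabla_def bilinear_ladd bilinear_radd)
qed

lemma nabla_differentiable:
  assumes "x \<in> V" and Z: "twice_differentiable_on Z V" and Y: "Y differentiable at x"
  shows "nabla g Y Z differentiable at x"
proof -
  have Z1: "Z differentiable at y" "(\<lambda>y. dd Z y v) differentiable at y" if "y \<in> V" for y v
    using Z that unfolding twice_differentiable_on_def by auto
  have "(\<lambda>y. dd Z y (Y y)) differentiable at x"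
    using has_derivative_linear_family[where L = "dd Z", OF open_V assms(1) linear_dd[OF Z1(1)] Z1(2)[OF assms(1)]
        has_derivative_dd[OF Y]] unfolding differentiable_def by blast
  moreover have "(\<lambda>y. \<Gamma> y (Y y) (Z y)) differentiable at x"
    using has_derivative_bilinear_family[where a = \<Gamma>, OF open_V assms(1) \<Gamma>_bilinear
        \<Gamma>_differentiable[OF assms(1)] has_derivative_dd[OF Y] has_derivative_dd[OF Z1(1)[OF assms(1)]]]
    unfolding differentiable_def by blast
  ultimately show ?thesis unfolding nabla_def by (rule differentiable_add)
qed

text \<open>
  The infinitesimal form of the invariance of a parallel form under holonomy.  Differentiating
  \<open>f = a (Z, W)\<close> twice by the Leibniz rule, the mixed terms \<open>a (nabla X Z, nabla Y W)\<close> and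
  \<open>a (nabla Y Z, nabla X W)\<close> are symmetric in \<open>X\<close> and \<open>Y\<close>, so that \<open>X Y f - Y X f - [X, Y] f = 0\<close>
  leaves the curvature terms only.
\<close>

lemma curvature_skew:
  assumes a: "parallel_form a" and "x \<in> V"
    and X: "\<And>y. y \<in> V \<Longrightarrow> X differentiable at y" and Y: "\<And>y. y \<in> V \<Longrightarrow> Y differentiable at y"
    and Z: "twice_differentiable_on Z V" and W: "twice_differentiable_on W V"
  shows "a x (curvature g X Y Z x) (W x) + a x (Z x) (curvature g X Y W x) = 0"
proof -
  define f where "f = (\<lambda>y. a y (Z y) (W y))"
  have Z1: "Z differentiable at y" and W1: "W differentiable at y" if "y \<in> V" for y
    using Z W that unfolding twice_differentiable_on_def by auto
  have f1: "f differentiable at y"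
    and Df: "dd f y (T y) = a y (nabla g T Z y) (W y) + a y (Z y) (nabla g T W y)"
    if "y \<in> V" for y T
    using parallel_form_leibniz[OF a that Z1[OF that] W1[OF that]] unfolding f_def by auto
  have Tf: "(\<lambda>y. dd f y (T y)) differentiable at y"
    and DTf: "dd (\<lambda>y. dd f y (T y)) y (S y) =
        a y (nabla g S (nabla g T Z) y) (W y) + a y (nabla g T Z y) (nabla g S W y)
        + (a y (nabla g S Z y) (nabla g T W y) + a y (Z y) (nabla g S (nabla g T W) y))"
    if y: "y \<in> V" and T: "T differentiable at y" for y S T
  proof -
    note NZ = nabla_differentiable[OF y Z T] and NW = nabla_differentiable[OF y W T]
    note 1 = parallel_form_leibniz[OF a y NZ W1[OF y]]
    note 2 = parallel_form_leibniz[OF a y Z1[OF y] NW]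
    let ?r = "\<lambda>y. a y (nabla g T Z y) (W y) + a y (Z y) (nabla g T W y)"
    have t1: "dd (\<lambda>y. dd f y (T y)) y = dd ?r y"
      by (rule dd_transform(1)[OF open_V y]) (rule Df)
    have t2: "(\<lambda>y. dd f y (T y)) differentiable at y \<longleftrightarrow> ?r differentiable at y"
      by (rule dd_transform(2)[OF open_V y]) (rule Df)
    show "(\<lambda>y. dd f y (T y)) differentiable at y"
      unfolding t2 by (rule differentiable_add[OF 1(1) 2(1)])
    show "dd (\<lambda>y. dd f y (T y)) y (S y) =
        a y (nabla g S (nabla g T Z) y) (W y) + a y (nabla g T Z y) (nabla g S W y)
        + (a y (nabla g S Z y) (nabla g T W y) + a y (Z y) (nabla g S (nabla g T W) y))"
      unfolding t1 dd_eq[OF has_derivative_add[OF has_derivative_dd[OF 1(1)] has_derivative_dd[OF 2(1)]]]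
        1(2) 2(2) ..
  qed
  have "twice_differentiable_on f V"
    unfolding twice_differentiable_on_def using f1 Tf[of _ "\<lambda>_. _"] by simp
  from lie_bracket_commutator[OF open_V \<open>x \<in> V\<close> this X[OF \<open>x \<in> V\<close>] Y[OF \<open>x \<in> V\<close>]]
  show ?thesis
    unfolding DTf[OF \<open>x \<in> V\<close> X[OF \<open>x \<in> V\<close>]] DTf[OF \<open>x \<in> V\<close> Y[OF \<open>x \<in> V\<close>]] Df[OF \<open>x \<in> V\<close>]
      curvature_def
    using parallel_formD(1)[OF a \<open>x \<in> V\<close>] by (simp add: bilinear_lsub bilinear_rsub)
qed

section \<open>Consequences of the maximal rank of the Jacobi operator\<close>

text \<open>
  Let \<open>J\<close> be the Jacobi operator of \<open>\<xi>\<close>.  Skewness of the curvature for the metric itself shows that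
  the image of \<open>J\<close> is orthogonal to \<open>\<xi>\<close>, and by the rank hypothesis it spans all of the orthogonal
  complement.  Skewness for \<open>a\<close> gives \<open>a (J X, \<xi>) = 0\<close>, so \<open>a (v, \<xi>) = c g (v, \<xi>)\<close> for all \<open>v\<close>,
  where \<open>c = a (\<xi>, \<xi>)\<close>.  Skewness once more gives
  \<open>a (J X, w) = - a (\<xi>, R W) = - c g (\<xi>, R W) = c g (J X, w)\<close>, where \<open>W\<close> is the constant field \<open>w\<close> and
  \<open>R W\<close> is its curvature in the directions \<open>X\<close>, \<open>\<xi>\<close>; hence \<open>a = c g\<close> on the image of \<open>J\<close> and on \<open>\<xi>\<close>.
\<close>

lemma parallel_form_proportional_at:
  assumes a: "parallel_form a" and "x \<in> V" and \<xi>: "twice_differentiable_on \<xi> V"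
    and unit: "g x (\<xi> x) (\<xi> x) = 1"
    and \<X>: "\<And>X y. X \<in> \<X> \<Longrightarrow> y \<in> V \<Longrightarrow> X differentiable at y"
    and rank: "Suc (dim ((\<lambda>X. jacobi_operator g \<xi> X x) ` \<X>)) = DIM('b)"
  shows "a x v w = a x (\<xi> x) (\<xi> x) * g x v w"
proof -
  define I where "I = (\<lambda>X. jacobi_operator g \<xi> X x) ` \<X>"
  define H where "H = {v. g x v (\<xi> x) = 0}"
  have \<xi>1: "\<And>y. y \<in> V \<Longrightarrow> \<xi> differentiable at y"
    using \<xi> unfolding twice_differentiable_on_def by auto
  have lin: "linear (\<lambda>v. b x v w)" "linear (\<lambda>w. b x v w)" if "parallel_form b" for b v w
    using parallel_formD(1)[OF that \<open>x \<in> V\<close>] by (auto simp: bilinear_def)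
  have skew: "b x (jacobi_operator g \<xi> X x) (W x) + b x (\<xi> x) (curvature g X \<xi> W x) = 0"
    if "X \<in> \<X>" "parallel_form b" "twice_differentiable_on W V" for b X W
    unfolding jacobi_operator_def by (rule curvature_skew[OF that(2) \<open>x \<in> V\<close> \<X>[OF that(1)] \<xi>1 \<xi> that(3)])
  have perp: "b x u (\<xi> x) = 0" if "u \<in> I" "parallel_form b" for b u
    using that skew[OF _ that(2) \<xi>] parallel_formD(2)[OF that(2) \<open>x \<in> V\<close>]
    unfolding I_def jacobi_operator_def by fastforce
  have "subspace H"
    unfolding H_def subspace_def
    using linear_0[OF lin(1)[OF parallel_form_metric]] linear_add[OF lin(1)[OF parallel_form_metric]]
      linear_cmul[OF lin(1)[OF parallel_form_metric]] by auto
  have IH: "I \<subseteq> H" using perp[OF _ parallel_form_metric] unfolding H_def by auto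
  then have "span I \<subseteq> H" using \<open>subspace H\<close> span_minimal by blast
  \<comment> \<open>The proper subspace \<open>H\<close> contains \<open>I\<close>, whose span has codimension one.\<close>
  have "\<xi> x \<notin> H" using unit unfolding H_def by simp
  then have "H \<noteq> UNIV" by blast
  then have "span H \<subset> span UNIV"
    by (simp only: span_eq_iff[THEN iffD2, OF \<open>subspace H\<close>] span_UNIV) blast
  then have "dim H < DIM('b)" using dim_psubset[of H UNIV] by (simp add: dim_UNIV)
  then have "dim H \<le> dim (span I)" using rank unfolding I_def by simp
  then have H: "span I = H"
    using subspace_dim_equal[OF subspace_span \<open>subspace H\<close> \<open>span I \<subseteq> H\<close>] by simp
  have decomp: "v - g x v (\<xi> x) *\<^sub>R \<xi> x \<in> span I" for v
    unfolding H H_def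
    using unit linear_diff[OF lin(1)[OF parallel_form_metric]] linear_cmul[OF lin(1)[OF parallel_form_metric]]
    by simp
  have eq_on: "L v = L' v" if "linear L" "linear L'" "\<And>v. v \<in> I \<Longrightarrow> L v = L' v" "L (\<xi> x) = L' (\<xi> x)"
    for L L' :: "'b \<Rightarrow> real" and v
  proof -
    have "L (v - g x v (\<xi> x) *\<^sub>R \<xi> x) = L' (v - g x v (\<xi> x) *\<^sub>R \<xi> x)"
      by (rule linear_eq_on[OF that(1,2) decomp that(3)])
    then show ?thesis by (simp add: linear_diff linear_cmul that)
  qed
  define c where "c = a x (\<xi> x) (\<xi> x)"
  have cg: "linear (\<lambda>v. c * g x v w)" for w
    using lin(1)[OF parallel_form_metric] by (auto simp: linear_iff algebra_simps)
  have a\<xi>: "a x v (\<xi> x) = c * g x v (\<xi> x)" for v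
    by (rule eq_on[OF lin(1)[OF a] cg])
      (simp_all add: perp a parallel_form_metric unit c_def)
  have a\<xi>': "a x (\<xi> x) w = c * g x (\<xi> x) w" for w
    using a\<xi>[of w] parallel_formD(2)[OF a \<open>x \<in> V\<close>, of w] g_sym[OF \<open>x \<in> V\<close>, of w] by simp
  have "a x v w = c * g x v w"
  proof (rule eq_on[OF lin(1)[OF a] cg])
    fix v assume "v \<in> I"
    then obtain X where X: "X \<in> \<X>" "v = jacobi_operator g \<xi> X x" unfolding I_def by blast
    note skew = skew[OF X(1) _ twice_differentiable_on_const[of w], folded X(2)]
    have "a x v w = - a x (\<xi> x) (curvature g X \<xi> (\<lambda>_. w) x)" using skew[OF a] by simp
    also have "\<dots> = c * (- g x (\<xi> x) (curvature g X \<xi> (\<lambda>_. w) x))"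
      using a\<xi>' by simp
    also have "- g x (\<xi> x) (curvature g X \<xi> (\<lambda>_. w) x) = g x v w"
      using skew[OF parallel_form_metric] by simp
    finally show "a x v w = c * g x v w" .
  qed (rule a\<xi>')
  then show ?thesis unfolding c_def .
qed

text \<open>
  If \<open>a = c g\<close> at \<open>x\<close>, then the derivative of \<open>a (\<xi>, \<xi>)\<close> at \<open>x\<close> is \<open>2 a (nabla \<xi>, \<xi>) = 2 c g (nabla \<xi>, \<xi>)\<close>,
  which is \<open>c\<close> times the derivative of the constant function \<open>g (\<xi>, \<xi>) = 1\<close>.
\<close>

lemma proportionality_factor_derivative:
  assumes a: "parallel_form a" and "x \<in> V" and \<xi>: "\<xi> differentiable at x"
    and unit: "\<And>y. y \<in> V \<Longrightarrow> g y (\<xi> y) (\<xi> y) = 1"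
    and proportional: "\<And>v w. a x v w = c * g x v w"
  shows "((\<lambda>y. a y (\<xi> y) (\<xi> y)) has_derivative (\<lambda>_. 0)) (at x)"
proof -
  have "dd (\<lambda>y. a y (\<xi> y) (\<xi> y)) x = (\<lambda>_. 0)"
  proof
    fix u
    have "dd (\<lambda>y. a y (\<xi> y) (\<xi> y)) x u = c * dd (\<lambda>y. g y (\<xi> y) (\<xi> y)) x u"
      using parallel_form_leibniz(2)[OF a \<open>x \<in> V\<close> \<xi> \<xi>, of "\<lambda>_. u"]
        parallel_form_leibniz(2)[OF parallel_form_metric \<open>x \<in> V\<close> \<xi> \<xi>, of "\<lambda>_. u"]
      by (simp add: proportional algebra_simps)
    also have "dd (\<lambda>y. g y (\<xi> y) (\<xi> y)) x = dd (\<lambda>_. 1) x"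
      by (rule dd_transform(1)[OF open_V \<open>x \<in> V\<close> unit])
    finally show "dd (\<lambda>y. a y (\<xi> y) (\<xi> y)) x u = 0"
      by (simp add: dd_eq[OF has_derivative_const])
  qed
  then show ?thesis
    using has_derivative_dd[OF parallel_form_leibniz(1)[OF a \<open>x \<in> V\<close> \<xi> \<xi>]]
    by simp
qed

end

section \<open>Pull-backs along the factors of a splitting\<close>

definition pullback :: "'c::euclidean_space local_metric \<Rightarrow> ('b::euclidean_space \<Rightarrow> 'c) \<Rightarrow> 'b local_metric" where
  "pullback h P x v w = h (P x) (dd P x v) (dd P x w)"

text \<open>
  Here \<open>S\<close> is the covariant second derivative of \<open>P\<close>, taken with the connection of \<open>h\<close> in the target
  and the flat one in the source.
\<close>

lemma pullback_derivative:
  fixes P :: "'b::euclidean_space \<Rightarrow> 'c::euclidean_space"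
  assumes "metric_on W h" "open V" "x \<in> V" and P: "twice_differentiable_on P V" and PV: "P ` V \<subseteq> W"
  defines "S \<equiv> \<lambda>u v. christoffel h (P x) (dd P x u) (dd P x v) + dd (\<lambda>y. dd P y v) x u"
  shows "(\<lambda>y. pullback h P y v w) differentiable at x"
    and "dd (\<lambda>y. pullback h P y v w) x u = h (P x) (S u v) (dd P x w) + h (P x) (dd P x v) (S u w)"
proof -
  interpret h: metric_on W h by fact
  note P1 = twice_differentiable_onD[OF P]
  have Px: "P x \<in> W" using PV \<open>x \<in> V\<close> by blast
  have hP: "((\<lambda>y. h (P y) a b) has_derivative (\<lambda>u. dd (\<lambda>z. h z a b) (P x) (dd P x u))) (at x)" for a b
    by (rule has_derivative_compose[OF has_derivative_dd[OF P1(1)[OF \<open>x \<in> V\<close>]]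
      has_derivative_dd[OF twice_differentiable_onD(1)[OF h.g_twice Px]]])
  have bil: "bilinear (h (P y))" if "y \<in> V" for y using h.g_bilinear PV that by blast
  have D: "((\<lambda>y. h (P y) (dd P y v) (dd P y w)) has_derivative
      (\<lambda>u. dd (\<lambda>y. h (P y) (dd P x v) (dd P x w)) x u + h (P x) (dd (\<lambda>y. dd P y v) x u) (dd P x w)
        + h (P x) (dd P x v) (dd (\<lambda>y. dd P y w) x u))) (at x)"
    by (rule has_derivative_bilinear_family[where a = "\<lambda>y. h (P y)", OF \<open>open V\<close> \<open>x \<in> V\<close> bil _
          has_derivative_dd[OF P1(2)[OF \<open>x \<in> V\<close>]] has_derivative_dd[OF P1(2)[OF \<open>x \<in> V\<close>]]])
      (use hP in \<open>auto simp: differentiable_def\<close>)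
  then show "(\<lambda>y. pullback h P y v w) differentiable at x"
    unfolding pullback_def differentiable_def by blast
  show "dd (\<lambda>y. pullback h P y v w) x u = h (P x) (S u v) (dd P x w) + h (P x) (dd P x v) (S u w)"
    unfolding pullback_def S_def
    using bil[OF \<open>x \<in> V\<close>]
    by (simp add: dd_eq[OF D] dd_eq[OF hP] h.dd_g[OF Px] bilinear_ladd bilinear_radd)
qed

lemma pullback_bilinear:
  assumes "bilinear (h (P x))" "P differentiable at x"
  shows "bilinear (pullback h P x)"
  using assms(1) linear_dd[OF assms(2)]
  unfolding pullback_def bilinear_def by (auto simp: linear_iff)

context metric_on
begin

text \<open>
  When a metric splits as a sum of pull-backs along \<open>P\<close> and \<open>Q\<close>, whose derivatives together are
  bijective, there is a unique bilinear map \<open>G\<close> satisfying \<open>dd P x (G u v) = S u v\<close> and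
  \<open>dd Q x (G u v) = R u v\<close>, where \<open>S\<close> and \<open>R\<close> are the second derivatives in \<open>pullback_derivative\<close>.
  Both pull-backs are parallel for the symmetric connection \<open>G\<close>, hence so is their sum, the metric; by
  uniqueness of the Christoffel symbols \<open>G\<close> is the Levi-Civita connection.
\<close>

lemma parallel_form_pullback:
  fixes P :: "'b \<Rightarrow> 'c::euclidean_space" and Q :: "'b \<Rightarrow> 'd::euclidean_space"
  assumes h: "metric_on W h" and k: "metric_on T k"
    and P: "twice_differentiable_on P V" "P ` V \<subseteq> W"
    and Q: "twice_differentiable_on Q V" "Q ` V \<subseteq> T"
    and split: "\<And>x v w. x \<in> V \<Longrightarrow> g x v w = pullback h P x v w + pullback k Q x v w"
    and surj: "\<And>x. x \<in> V \<Longrightarrow> surj (\<lambda>v. (dd P x v, dd Q x v))"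
  shows "parallel_form (pullback h P)"
  unfolding parallel_form_def
proof (intro ballI conjI allI)
  interpret h: metric_on W h by fact
  interpret k: metric_on T k by fact
  fix x assume "x \<in> V"
  note P1 = twice_differentiable_onD[OF P(1) \<open>x \<in> V\<close>] and Q1 = twice_differentiable_onD[OF Q(1) \<open>x \<in> V\<close>]
  have Px: "P x \<in> W" and Qx: "Q x \<in> T" using P(2) Q(2) \<open>x \<in> V\<close> by auto
  define S where "S = (\<lambda>u v. h.\<Gamma> (P x) (dd P x u) (dd P x v) + dd (\<lambda>y. dd P y v) x u)"
  define R where "R = (\<lambda>u v. k.\<Gamma> (Q x) (dd Q x u) (dd Q x v) + dd (\<lambda>y. dd Q y v) x u)"
  note DP = pullback_derivative[OF h open_V \<open>x \<in> V\<close> P, folded S_def]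
  note DQ = pullback_derivative[OF k open_V \<open>x \<in> V\<close> Q, folded R_def]
  show "bilinear (pullback h P x)"
    by (rule pullback_bilinear) (rule h.g_bilinear[OF Px], rule P1(1))
  show "pullback h P x v w = pullback h P x w v" for v w
    unfolding pullback_def by (rule h.g_sym[OF Px])
  show "(\<lambda>z. pullback h P z v w) differentiable at x" for v w
    by (rule DP(1))
  have S_sym: "S u v = S v u" and R_sym: "R u v = R v u" for u v
    unfolding S_def R_def
    using h.\<Gamma>_sym[OF Px] k.\<Gamma>_sym[OF Qx] symmetric_second_derivative[OF open_V \<open>x \<in> V\<close> P(1)]
      symmetric_second_derivative[OF open_V \<open>x \<in> V\<close> Q(1)] by metis+
  have lin: "linear (\<lambda>u. S u v)" "linear (\<lambda>u. R u v)" for v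
    unfolding S_def R_def
    using h.\<Gamma>_bilinear[OF Px] k.\<Gamma>_bilinear[OF Qx] linear_dd[OF P1(1)] linear_dd[OF Q1(1)]
      linear_dd[OF P1(2)[of v]] linear_dd[OF Q1(2)[of v]]
    by (auto simp: linear_iff bilinear_def algebra_simps)
  define L where "L = (\<lambda>v. (dd P x v, dd Q x v))"
  have linL: "linear L"
    unfolding L_def using linear_dd[OF P1(1)] linear_dd[OF Q1(1)] by (auto simp: linear_iff)
  have "inj L"
  proof (subst linear_injective_0[OF linL], intro allI impI)
    fix v assume "L v = 0"
    then have "dd P x v = 0" "dd Q x v = 0" by (auto simp: L_def zero_prod_def)
    then have "g x v w = 0" for w
      using h.g_bilinear[OF Px] k.g_bilinear[OF Qx]
      by (simp add: split[OF \<open>x \<in> V\<close>] pullback_def bilinear_lzero)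
    then show "v = 0" by (rule g_nondeg[OF \<open>x \<in> V\<close>])
  qed
  define G where "G = (\<lambda>u v. inv L (S u v, R u v))"
  have G: "L (G u v) = (S u v, R u v)" for u v
    unfolding G_def using surj[OF \<open>x \<in> V\<close>, folded L_def] by (rule surj_f_inv_f)
  have G1: "dd P x (G u v) = S u v" "dd Q x (G u v) = R u v" for u v
    using G[of u v] by (auto simp: L_def)
  have G_sym: "G u v = G v u" for u v
    by (rule injD[OF \<open>inj L\<close>]) (simp add: G S_sym[of u v] R_sym[of u v])
  have linG: "linear (\<lambda>u. G u v)" for v
  proof (rule linearI; rule injD[OF \<open>inj L\<close>])
    show "L (G (a + b) v) = L (G a v + G b v)" for a b
      by (simp add: linear_add[OF linL] G linear_add[OF lin(1)] linear_add[OF lin(2)])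
    show "L (G (r *\<^sub>R b) v) = L (r *\<^sub>R G b v)" for r b
      by (simp add: linear_cmul[OF linL] G linear_cmul[OF lin(1)] linear_cmul[OF lin(2)])
  qed
  have par: "dd (\<lambda>z. pullback h P z v w) x u = pullback h P x (G u v) w + pullback h P x v (G u w)"
       "dd (\<lambda>z. pullback k Q z v w) x u = pullback k Q x (G u v) w + pullback k Q x v (G u w)" for u v w
    using DP(2)[of v w u] DQ(2)[of v w u] by (simp_all add: pullback_def G1 S_def R_def)
  have "is_christoffel g x G"
    unfolding is_christoffel_def
  proof (intro conjI allI)
    show "bilinear G" using linG G_sym by (simp add: bilinear_def)
    show "G u v = G v u" for u v by (rule G_sym)
    fix u v w
    have "dd (\<lambda>z. g z v w) x = dd (\<lambda>z. pullback h P z v w + pullback k Q z v w) x"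
      by (rule dd_transform(1)[OF open_V \<open>x \<in> V\<close>]) (rule split)
    also have "\<dots> = (\<lambda>u. dd (\<lambda>z. pullback h P z v w) x u + dd (\<lambda>z. pullback k Q z v w) x u)"
      by (rule dd_eq[OF has_derivative_add[OF has_derivative_dd[OF DP(1)] has_derivative_dd[OF DQ(1)]]])
    finally show "dd (\<lambda>z. g z v w) x u = g x (G u v) w + g x v (G u w)"
      by (simp add: par split[OF \<open>x \<in> V\<close>])
  qed
  then have "\<Gamma> x = G" by (rule \<Gamma>_eqI[OF \<open>x \<in> V\<close>])
  then show "dd (\<lambda>z. pullback h P z v w) x u
      = pullback h P x (\<Gamma> x u v) w + pullback h P x v (\<Gamma> x u w)" for u v w
    using par(1) by simp
qed

text \<open>
  Vectors tangent to the factor \<open>Q\<close> are in the kernel of the pull-back along \<open>P\<close>, which forces \<open>c = 0\<close>;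
  then vectors tangent to the factor \<open>P\<close> are in the kernel of the metric.  Both kinds of non-zero vectors
  exist since the factors have positive dimension.
\<close>

lemma pullback_not_proportional:
  fixes P :: "'b \<Rightarrow> 'c::euclidean_space" and Q :: "'b \<Rightarrow> 'd::euclidean_space"
  assumes "x \<in> V" and bil: "bilinear (h (P x))" "bilinear (k (Q x))"
    and split: "\<And>v w. g x v w = pullback h P x v w + pullback k Q x v w"
    and surj: "surj (\<lambda>v. (dd P x v, dd Q x v))"
    and lin: "linear (dd P x)" "linear (dd Q x)"
    and proportional: "\<And>v w. pullback h P x v w = c * g x v w"
  shows False
proof -
  obtain b :: 'c where "b \<in> Basis" using nonempty_Basis by blast
  obtain d :: 'd where "d \<in> Basis" using nonempty_Basis by blast
  obtain v where v: "dd P x v = 0" "dd Q x v = d"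
    using surj unfolding surj_def by (metis prod.inject)
  obtain w where w: "dd P x w = b" "dd Q x w = 0"
    using surj unfolding surj_def by (metis prod.inject)
  have "v \<noteq> 0" "w \<noteq> 0"
    using v w lin nonzero_Basis[OF \<open>b \<in> Basis\<close>] nonzero_Basis[OF \<open>d \<in> Basis\<close>] linear_0 by metis+
  have "c * g x v u = 0" for u
    using proportional[of v u] v(1) bil(1) by (simp add: pullback_def bilinear_lzero)
  then have "c = 0" using g_nondeg[OF \<open>x \<in> V\<close>, of v] \<open>v \<noteq> 0\<close> by auto
  have "g x w u = 0" for u
    using split[of w u] proportional[of w u] \<open>c = 0\<close> w(2) bil(2) by (simp add: pullback_def bilinear_lzero)
  then show False using g_nondeg[OF \<open>x \<in> V\<close>, of w] \<open>w \<noteq> 0\<close> by auto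
qed

end

section \<open>From charts to the manifold\<close>

lemma metric_on_subset:
  assumes "metric_on V g" "open W" "W \<subseteq> V"
  shows "metric_on W g"
proof -
  interpret metric_on V g by fact
  show ?thesis
    using assms(2,3) g_bilinear g_sym g_nondeg g_twice
    unfolding metric_on_def twice_differentiable_on_def by blast
qed

lemma smooth_on_const: "smooth_on S (\<lambda>_. c)"
proof -
  have "Ck_on k S (\<lambda>_. c)" for k
    by (induction k arbitrary: c) (simp_all add: dd_eq[OF has_derivative_const])
  then show ?thesis by (simp add: smooth_on_def)
qed

lemma smooth_on_imp_twice_differentiable_on:
  assumes "open S" "smooth_on S f"
  shows "twice_differentiable_on f S"
proof -
  have "Ck_on (Suc (Suc 0)) S f" using assms(2) unfolding smooth_on_def by blast
  then show ?thesis
    using assms(1) unfolding twice_differentiable_on_def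
    by (auto simp: differentiable_on_eq_differentiable_at)
qed

lemma smooth_manifoldD:
  assumes "smooth_manifold M" "i \<in> idx M"
  shows "open (chart_dom M i)" "open (chart_image M i)" "continuous_on (chart_dom M i) (coord M i)"
    "continuous_on (chart_image M i) (chart_inv M i)" "inj_on (coord M i) (chart_dom M i)"
    "p \<in> chart_dom M i \<Longrightarrow> chart_inv M i (coord M i p) = p"
proof -
  have h: "homeomorphism (chart_dom M i) (chart_image M i) (coord M i) (chart_inv M i)"
    and o: "open (chart_dom M i)" "open (chart_image M i)"
    using assms unfolding smooth_manifold_def by auto
  show "open (chart_dom M i)" "open (chart_image M i)" by fact+
  show "continuous_on (chart_dom M i) (coord M i)" "continuous_on (chart_image M i) (chart_inv M i)"
    using h by (auto simp: homeomorphism_def)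
  show inv: "p \<in> chart_dom M i \<Longrightarrow> chart_inv M i (coord M i p) = p" for p
    using h by (auto simp: homeomorphism_def)
  show "inj_on (coord M i) (chart_dom M i)" using inv by (rule inj_on_inverseI)
qed

lemma metric_on_chart:
  assumes "smooth_manifold M" "pseudo_riemannian_metric M g" "i \<in> idx M"
  shows "metric_on (chart_image M i) (g i)"
proof -
  note o = smooth_manifoldD(2)[OF assms(1,3)]
  have "smooth_on (chart_image M i) (\<lambda>x. g i x v w)" for v w
    using assms(2,3) unfolding pseudo_riemannian_metric_def symmetric_tensor_def tensor02_def by blast
  then show ?thesis
    using assms(2,3) o smooth_on_imp_twice_differentiable_on[OF o]
    unfolding pseudo_riemannian_metric_def symmetric_tensor_def tensor02_def metric_on_def by blast
qed

lemma parallel_form_chart: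
  assumes M: "smooth_manifold M" and g: "pseudo_riemannian_metric M g" and i: "i \<in> idx M"
    and a: "symmetric_tensor M a" and par: "parallel M g a"
  shows "metric_on.parallel_form (chart_image M i) (g i) (a i)"
proof -
  interpret metric_on "chart_image M i" "g i" by (rule metric_on_chart[OF M g i])
  have sm: "smooth_on (chart_image M i) (\<lambda>x. a i x v w)" for v w
    using a i unfolding symmetric_tensor_def tensor02_def by blast
  have "dd (\<lambda>z. a i z v w) y u = a i y (christoffel (g i) y u v) w + a i y v (christoffel (g i) y u w)"
    if "y \<in> chart_image M i" for y u v w
  proof -
    have "nabla_tensor02 (g i) (a i) (\<lambda>_. u) (\<lambda>_. v) (\<lambda>_. w) y = 0"
      using par i that smooth_on_const unfolding parallel_def by blast
    then show ?thesis
      by (simp add: nabla_tensor02_def nabla_def dd_eq[OF has_derivative_const])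
  qed
  then show ?thesis
    using a i twice_differentiable_onD(1)[OF smooth_on_imp_twice_differentiable_on[OF open_V sm]]
    unfolding parallel_form_def symmetric_tensor_def tensor02_def by auto
qed

text \<open>
  Since \<open>\<phi>\<^sup>2 \<xi> = 0\<close>, applying \<open>\<phi>\<^sup>2\<close> to \<open>z = \<phi> \<xi>\<close> shows that \<open>z\<close> is a multiple of \<open>\<xi>\<close>; applying \<open>\<phi>\<close> to
  this relation gives \<open>z = 0\<close>.  Now evaluate the compatibility of \<open>\<phi>\<close> with the metric at \<open>(\<xi>, \<xi>)\<close>.
\<close>

lemma characteristic_field_unit:
  assumes "almost_para_contact_metric M \<epsilon> \<phi> \<xi> \<eta> g" "i \<in> idx M" "x \<in> chart_image M i"
  shows "g i x (\<xi> i x) (\<xi> i x) = 1"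
proof -
  have \<epsilon>: "\<epsilon> = 1 \<or> \<epsilon> = -1"
    and sq: "\<And>v. \<phi> i x (\<phi> i x v) = \<epsilon> *\<^sub>R (v - \<eta> i x v *\<^sub>R \<xi> i x)"
    and \<eta>: "\<eta> i x (\<xi> i x) = 1"
    and g: "\<And>v w. g i x (\<phi> i x v) (\<phi> i x w) = - \<epsilon> * (g i x v w - \<eta> i x v * \<eta> i x w)"
    and lin: "linear (\<phi> i x)" and bil: "bilinear (g i x)"
    using assms unfolding almost_para_contact_metric_def tensor11_def pseudo_riemannian_metric_def
      symmetric_tensor_def tensor02_def by auto
  let ?z = "\<phi> i x (\<xi> i x)"
  have 0: "\<phi> i x ?z = 0" using sq[of "\<xi> i x"] \<eta> by simp
  then have "\<epsilon> *\<^sub>R (?z - \<eta> i x ?z *\<^sub>R \<xi> i x) = 0"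
    using sq[of ?z] linear_0[OF lin] by simp
  then have z: "?z = \<eta> i x ?z *\<^sub>R \<xi> i x" using \<epsilon> by auto
  then have "\<eta> i x ?z *\<^sub>R ?z = 0" using 0 linear_cmul[OF lin] by metis
  then have "?z = 0" using z by (metis scaleR_eq_0_iff)
  then show ?thesis
    using g[of "\<xi> i x" "\<xi> i x"] \<eta> \<epsilon> bilinear_lzero[OF bil] by auto
qed

text \<open>
  The characteristic vector field enters the argument through its unit length and the rank of its
  Jacobi operator.
\<close>

locale maximal_jacobi_rank =
  fixes M :: "('i, 'm::{t2_space, second_countable_topology}, 'b::euclidean_space) atlas"
    and \<xi> :: "('i, 'b) vector_field" and g :: "('i, 'b) tensor02"
  assumes manifold: "smooth_manifold M" and metric: "pseudo_riemannian_metric M g"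
    and field: "vector_field M \<xi>"
    and unit: "\<And>i x. i \<in> idx M \<Longrightarrow> x \<in> chart_image M i \<Longrightarrow> g i x (\<xi> i x) (\<xi> i x) = 1"
    and rank: "\<And>i x. i \<in> idx M \<Longrightarrow> x \<in> chart_image M i \<Longrightarrow> Suc (jacobi_rank M g \<xi> i x) = DIM('b)"
begin

lemma twice_differentiable_\<xi>: "i \<in> idx M \<Longrightarrow> twice_differentiable_on (\<xi> i) (chart_image M i)"
  using field smooth_on_imp_twice_differentiable_on[OF smooth_manifoldD(2)[OF manifold]]
  unfolding vector_field_def by blast

lemma parallel_form_proportional:
  assumes i: "i \<in> idx M" and V: "open V" "V \<subseteq> chart_image M i" "x \<in> V"
    and a: "metric_on.parallel_form V (g i) a"
  shows "a x v w = a x (\<xi> i x) (\<xi> i x) * g i x v w"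
proof -
  interpret metric_on V "g i"
    by (rule metric_on_subset[OF metric_on_chart[OF manifold metric i] V(1,2)])
  have x: "x \<in> chart_image M i" using V by blast
  show ?thesis
  proof (rule parallel_form_proportional_at[OF a \<open>x \<in> V\<close> _ unit[OF i x] _ rank[OF i x, unfolded jacobi_rank_def]])
    show "twice_differentiable_on (\<xi> i) V"
      using twice_differentiable_\<xi>[OF i] V(2) unfolding twice_differentiable_on_def by blast
    show "X differentiable at y" if "X \<in> {X. smooth_on (chart_image M i) X}" "y \<in> V" for X y
      using that V(2) twice_differentiable_onD(1)[OF smooth_on_imp_twice_differentiable_on[OF
          smooth_manifoldD(2)[OF manifold i]]] by blast
  qed
qed

lemma parallel_form_factor_locally_constant:
  assumes i: "i \<in> idx M" and x: "x \<in> chart_image M i"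
    and a: "metric_on.parallel_form (chart_image M i) (g i) a"
  shows "\<exists>r>0. ball x r \<subseteq> chart_image M i \<and>
    (\<forall>y\<in>ball x r. a y (\<xi> i y) (\<xi> i y) = a x (\<xi> i x) (\<xi> i x))"
proof -
  interpret metric_on "chart_image M i" "g i" by (rule metric_on_chart[OF manifold metric i])
  obtain r where r: "r > 0" "ball x r \<subseteq> chart_image M i"
    using open_V x open_contains_ball by blast
  have "a y (\<xi> i y) (\<xi> i y) = a x (\<xi> i x) (\<xi> i x)" if "y \<in> ball x r" for y
  proof (rule has_derivative_zero_unique_connected[of "ball x r" "\<lambda>y. a y (\<xi> i y) (\<xi> i y)"])
    show "((\<lambda>y. a y (\<xi> i y) (\<xi> i y)) has_derivative (\<lambda>_. 0)) (at z)" if "z \<in> ball x r" for z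
    proof -
      have z: "z \<in> chart_image M i" using that r by blast
      show ?thesis
        by (rule proportionality_factor_derivative[OF a z
              twice_differentiable_onD(1)[OF twice_differentiable_\<xi>[OF i] z] unit[OF i]
              parallel_form_proportional[OF i open_V order_refl z a]])
    qed
  qed (use r that in auto)
  then show ?thesis using r by blast
qed

text \<open>
  The proportionality factor \<open>a (\<xi>, \<xi>)\<close> transforms as a scalar, so the factors found in the charts fit
  together to one locally constant function on the connected set of points.
\<close>

lemma parallel_tensor_proportional:
  assumes conn: "connected (points M)" and a: "symmetric_tensor M a" and par: "parallel M g a"
  shows "\<exists>c. \<forall>i\<in>idx M. \<forall>x\<in>chart_image M i. \<forall>v w. a i x v w = c * g i x v w"
proof -
  define A where "A i x = a i x (\<xi> i x) (\<xi> i x)" for i x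
  define C where "C = (\<lambda>p. let i = SOME i. i \<in> idx M \<and> p \<in> chart_dom M i in A i (coord M i p))"
  have transfer: "A j (coord M j p) = A i (coord M i p)"
    if "i \<in> idx M" "j \<in> idx M" "p \<in> chart_dom M i" "p \<in> chart_dom M j" for i j p
  proof -
    let ?x = "coord M i p"
    have x: "?x \<in> overlap M i j" using that unfolding overlap_def by blast
    have t: "transition M i j ?x = coord M j p"
      using smooth_manifoldD(6)[OF manifold that(1,3)] unfolding transition_def by simp
    have "\<xi> j (coord M j p) = dtransition M i j ?x (\<xi> i ?x)"
      using field[unfolded vector_field_def, THEN conjunct2, rule_format, OF that(1,2) x] t by simp
    moreover have "a j (coord M j p) (dtransition M i j ?x v) (dtransition M i j ?x w) = a i ?x v w" for v w
      using a[unfolded symmetric_tensor_def tensor02_def, THEN conjunct1, THEN conjunct2, rule_format,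
          OF that(1,2) x] t by simp
    ultimately show ?thesis unfolding A_def by simp
  qed
  have C_eq: "C p = A i (coord M i p)" if "i \<in> idx M" "p \<in> chart_dom M i" for i p
  proof -
    define j where "j = (SOME i. i \<in> idx M \<and> p \<in> chart_dom M i)"
    have "j \<in> idx M \<and> p \<in> chart_dom M j" unfolding j_def by (rule someI) (use that in blast)
    then show ?thesis using transfer[OF that(1) _ that(2), of j] by (simp add: C_def Let_def j_def)
  qed
  have "C constant_on points M"
  proof (rule locally_constant_imp_constant[OF conn])
    fix p assume "p \<in> points M"
    then obtain i where i: "i \<in> idx M" "p \<in> chart_dom M i" unfolding points_def by blast
    then have x: "coord M i p \<in> chart_image M i" unfolding chart_image_def by blast
    have "\<exists>r>0. ball (coord M i p) r \<subseteq> chart_image M i \<and>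
        (\<forall>y\<in>ball (coord M i p) r. A i y = A i (coord M i p))"
      unfolding A_def by (rule parallel_form_factor_locally_constant[OF i(1) x
          parallel_form_chart[OF manifold metric i(1) a par]])
    then obtain r where r: "r > 0" "\<forall>y\<in>ball (coord M i p) r. A i y = A i (coord M i p)"
      by auto
    define T where "T = chart_dom M i \<inter> coord M i -` ball (coord M i p) r"
    have "open T"
      unfolding T_def
      by (rule continuous_open_preimage[OF smooth_manifoldD(3,1)[OF manifold i(1)] open_ball])
    moreover have "T \<subseteq> points M" using i(1) unfolding T_def points_def by blast
    moreover have "p \<in> T" using i(2) r(1) unfolding T_def by simp
    moreover have "\<forall>q\<in>T. C q = C p"
    proof
      fix q assume "q \<in> T"
      then have "q \<in> chart_dom M i" "A i (coord M i q) = A i (coord M i p)"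
        using r(2) unfolding T_def by auto
      then show "C q = C p" by (simp only: C_eq[OF i(1)] i(2))
    qed
    ultimately show "\<exists>T. openin (top_of_set (points M)) T \<and> p \<in> T \<and> (\<forall>x\<in>T. C x = C p)"
      using open_subset[of T "points M"] by (intro exI[of _ T] conjI)
  qed
  then obtain c where c: "\<And>p. p \<in> points M \<Longrightarrow> C p = c" unfolding constant_on_def by blast
  have "a i x v w = c * g i x v w" if i: "i \<in> idx M" and x: "x \<in> chart_image M i" for i x v w
  proof -
    obtain p where p: "p \<in> chart_dom M i" "x = coord M i p" using x unfolding chart_image_def by blast
    have "p \<in> points M" using p(1) i unfolding points_def by blast
    then have c_eq: "c = A i x" using c C_eq[OF i p(1)] p(2) by simp
    show ?thesis
      unfolding c_eq A_def
      by (rule parallel_form_proportional[OF i smooth_manifoldD(2)[OF manifold i] order_refl x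
          parallel_form_chart[OF manifold metric i a par]])
  qed
  then show ?thesis by blast
qed

end

section \<open>Local irreducibility\<close>

lemma open_image_if_continuous_inverse:
  assumes "open (C ` D)" "continuous_on (C ` D) I" "\<And>p. p \<in> D \<Longrightarrow> I (C p) = p" "open A" "A \<subseteq> D"
  shows "open (C ` A)"
proof -
  have "C ` A = C ` D \<inter> I -` A" using assms(3,5) by force
  then show ?thesis using continuous_open_preimage[OF assms(2,1,4)] by simp
qed

lemma product_chart:
  assumes N1: "smooth_manifold N1" "j \<in> idx N1" and N2: "smooth_manifold N2" "k \<in> idx N2"
  defines "N \<equiv> product_manifold N1 N2" and "D \<equiv> chart_dom N1 j \<times> chart_dom N2 k"
  shows "chart_dom N (j, k) = D" and "open D"
    and "r \<in> D \<Longrightarrow> coord N (j, k) r = (coord N1 j (fst r), coord N2 k (snd r))"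
    and "r \<in> D \<Longrightarrow> chart_inv N (j, k) (coord N (j, k) r) = r"
    and "open A \<Longrightarrow> A \<subseteq> D \<Longrightarrow> open (coord N (j, k) ` A)"
proof -
  note 1 = smooth_manifoldD[OF N1] and 2 = smooth_manifoldD[OF N2]
  let ?C = "coord N (j, k)"
  define I where "I = (\<lambda>z. (chart_inv N1 j (fst z), chart_inv N2 k (snd z)))"
  have C: "?C r = (coord N1 j (fst r), coord N2 k (snd r))" for r
    by (cases r) (simp add: N_def product_manifold_def)
  show dom: "chart_dom N (j, k) = D" by (simp add: N_def product_manifold_def D_def)
  show "open D" unfolding D_def by (rule open_Times[OF 1(1) 2(1)])
  show "r \<in> D \<Longrightarrow> ?C r = (coord N1 j (fst r), coord N2 k (snd r))" by (rule C)
  have IC: "I (?C r) = r" if "r \<in> D" for r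
    using that 1(6)[of "fst r"] 2(6)[of "snd r"] unfolding C I_def D_def by auto
  have "inj_on ?C D" using IC by (rule inj_on_inverseI)
  then show "r \<in> D \<Longrightarrow> chart_inv N (j, k) (?C r) = r"
    unfolding chart_inv_def dom by (rule inv_into_f_f)
  have img: "?C ` D = chart_image N1 j \<times> chart_image N2 k"
    unfolding C D_def chart_image_def by force
  have "continuous_on (chart_image N1 j \<times> chart_image N2 k) I"
    unfolding I_def
    by (intro continuous_on_Pair continuous_on_compose2[OF 1(4)] continuous_on_compose2[OF 2(4)]
        continuous_on_fst continuous_on_snd continuous_on_id) auto
  then show "open (?C ` A)" if "open A" "A \<subseteq> D"
    using open_image_if_continuous_inverse[of ?C D I, OF _ _ IC that] open_Times[OF 1(2) 2(2)]
    unfolding img by blast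
qed

lemma open_submanifold_chart:
  assumes M: "smooth_manifold M" "i \<in> idx M" and "open U"
  defines "M' \<equiv> open_submanifold M U"
  shows "chart_dom M' i = chart_dom M i \<inter> U" and "coord M' i = coord M i"
    and "q \<in> chart_dom M i \<inter> U \<Longrightarrow> chart_inv M' i (coord M i q) = q"
    and "open A \<Longrightarrow> A \<subseteq> chart_dom M i \<Longrightarrow> open (coord M i ` A)"
proof -
  note m = smooth_manifoldD[OF M]
  show dom: "chart_dom M' i = chart_dom M i \<inter> U" and coord: "coord M' i = coord M i"
    by (simp_all add: M'_def open_submanifold_def)
  have "inj_on (coord M i) (chart_dom M i \<inter> U)"
    using m(5) by (rule inj_on_subset) blast
  then show "q \<in> chart_dom M i \<inter> U \<Longrightarrow> chart_inv M' i (coord M i q) = q"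
    unfolding chart_inv_def dom coord by (rule inv_into_f_f)
  show "open (coord M i ` A)" if "open A" "A \<subseteq> chart_dom M i"
    by (rule open_image_if_continuous_inverse[of "coord M i" "chart_dom M i" "chart_inv M i"])
      (use m that in \<open>auto simp: chart_image_def\<close>)
qed

text \<open>
  The expression \<open>F\<close> of the isometry in a chart around \<open>p\<close> and a product chart around its image has
  components \<open>P\<close> and \<open>Q\<close>, along which the metric is the sum of pull-backs.  The derivative of \<open>F\<close> is
  surjective because the expression \<open>G\<close> of the inverse isometry is a differentiable right inverse of \<open>F\<close>
  on an open set.
\<close>

lemma isometry_chart_splitting:
  fixes M :: "('i, 'm::{t2_space, second_countable_topology}, 'b::euclidean_space) atlas"
    and N1 :: "('j, 'n::{t2_space, second_countable_topology}, 'c::euclidean_space) atlas"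
    and N2 :: "('k, 'p::{t2_space, second_countable_topology}, 'd::euclidean_space) atlas"
  assumes M: "smooth_manifold M" and N1: "smooth_manifold N1" and N2: "smooth_manifold N2"
    and U: "open U" "p \<in> U" "U \<subseteq> points M"
    and iso: "isometry (open_submanifold M U) g (product_manifold N1 N2) (product_metric h1 h2) f"
  obtains i j k V P Q x where "i \<in> idx M" "j \<in> idx N1" "k \<in> idx N2"
    "open V" "V \<subseteq> chart_image M i" "x \<in> V"
    "twice_differentiable_on P V" "P ` V \<subseteq> chart_image N1 j"
    "twice_differentiable_on Q V" "Q ` V \<subseteq> chart_image N2 k"
    "\<And>x v w. x \<in> V \<Longrightarrow> g i x v w = pullback (h1 j) P x v w + pullback (h2 k) Q x v w"
    "\<And>x. x \<in> V \<Longrightarrow> surj (\<lambda>v. (dd P x v, dd Q x v))"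
proof -
  let ?M = "open_submanifold M U" and ?N = "product_manifold N1 N2"
  have pts: "points ?M = U" using U(3) by (auto simp: points_def open_submanifold_def)
  define fi where "fi = inv_into (points ?M) f"
  have bij: "bij_betw f U (points ?N)" and sm: "smooth_map ?M ?N f" and smi: "smooth_map ?N ?M fi"
    and met: "\<And>i j x v w. i \<in> idx ?M \<Longrightarrow> j \<in> idx ?N \<Longrightarrow> x \<in> chart_expr_dom ?M ?N f i j \<Longrightarrow>
        product_metric h1 h2 j (chart_expr ?M ?N f i j x) (dd (chart_expr ?M ?N f i j) x v)
          (dd (chart_expr ?M ?N f i j) x w) = g i x v w"
    using iso unfolding isometry_def pts fi_def by auto
  have f_fi: "f (fi r) = r" "fi r \<in> U" if "r \<in> points ?N" for r
    using that bij_betw_inv_into_right[OF bij] bij_betw_imp_surj_on[OF bij] inv_into_into[of r f U]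
    unfolding fi_def pts by auto
  have fi_f: "fi (f q) = q" "f q \<in> points ?N" if "q \<in> U" for q
    using that bij_betw_inv_into_left[OF bij] bij_betwE[OF bij] unfolding fi_def pts by auto
  obtain i where i: "i \<in> idx M" "p \<in> chart_dom M i" using U unfolding points_def by blast
  obtain j k where jk: "j \<in> idx N1" "k \<in> idx N2" "f p \<in> chart_dom N1 j \<times> chart_dom N2 k"
    using fi_f(2)[OF U(2)] unfolding points_def by (auto simp: product_manifold_def)
  note m = open_submanifold_chart[OF M i(1) U(1)]
  note n = product_chart[OF N1 jk(1) N2 jk(2)]
  have idx: "i \<in> idx ?M" "(j, k) \<in> idx ?N"
    using i jk by (simp_all add: open_submanifold_def product_manifold_def)
  have D_pts: "chart_dom N1 j \<times> chart_dom N2 k \<subseteq> points ?N"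
    using idx(2) n(1) unfolding points_def by blast
  \<comment> \<open>The parts of the manifolds on which the expressions \<open>F\<close> and \<open>G\<close> below are defined.\<close>
  define A where "A = chart_dom M i \<inter> (U \<inter> f -` (chart_dom N1 j \<times> chart_dom N2 k))"
  define B where "B = (chart_dom N1 j \<times> chart_dom N2 k) \<inter> fi -` (chart_dom M i \<inter> U)"
  have "continuous_on U f" using sm unfolding smooth_map_def pts by blast
  then have "open A"
    unfolding A_def
    by (intro open_Int smooth_manifoldD(1)[OF M i(1)] continuous_open_preimage U(1) n(2))
  have "continuous_on (chart_dom N1 j \<times> chart_dom N2 k) fi"
    using smi D_pts unfolding smooth_map_def by (blast intro: continuous_on_subset)
  then have "open B"
    unfolding B_def
    by (intro continuous_open_preimage n(2) open_Int smooth_manifoldD(1)[OF M i(1)] U(1))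
  define F where "F = chart_expr ?M ?N f i (j, k)"
  define G where "G = chart_expr ?N ?M fi (j, k) i"
  define V where "V = coord M i ` A"
  define W where "W = coord ?N (j, k) ` B"
  have V: "V = chart_expr_dom ?M ?N f i (j, k)"
    unfolding V_def A_def chart_expr_dom_def m(1,2) n(1) by (simp add: Int_assoc)
  have W: "W = chart_expr_dom ?N ?M fi (j, k) i"
    unfolding W_def B_def chart_expr_dom_def m(1) n(1) ..
  have F_eq: "F (coord M i q) = coord ?N (j, k) (f q)" if "q \<in> A" for q
    using that m(3)[of q] unfolding F_def chart_expr_def A_def by simp
  have G_eq: "G (coord ?N (j, k) r) = coord M i (fi r)" if "r \<in> B" for r
    using that n(4)[of r] m(2) unfolding G_def chart_expr_def B_def by simp
  have "open V" unfolding V_def by (rule m(4)[OF \<open>open A\<close>]) (auto simp: A_def)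
  have "open W" unfolding W_def by (rule n(5)[OF \<open>open B\<close>]) (auto simp: B_def)
  have "smooth_on V F" using sm idx unfolding smooth_map_def V F_def by blast
  then have F: "twice_differentiable_on F V"
    by (rule smooth_on_imp_twice_differentiable_on[OF \<open>open V\<close>])
  have "smooth_on W G" using smi idx unfolding smooth_map_def W G_def by blast
  then have G: "twice_differentiable_on G W"
    by (rule smooth_on_imp_twice_differentiable_on[OF \<open>open W\<close>])
  have FG: "F (G z) = z" if "z \<in> W" for z
  proof -
    obtain r where r: "r \<in> B" "z = coord ?N (j, k) r" using \<open>z \<in> W\<close> unfolding W_def by blast
    then have r': "r \<in> points ?N" using D_pts unfolding B_def by blast
    then have "fi r \<in> A" using r(1) f_fi[OF r'] unfolding A_def B_def by auto
    then show ?thesis using r G_eq F_eq f_fi(1)[OF r'] by simp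
  qed
  have surjF: "surj (dd F x)" and F_in: "fst (F x) \<in> chart_image N1 j" "snd (F x) \<in> chart_image N2 k"
    if "x \<in> V" for x
  proof -
    obtain q where q: "q \<in> A" "x = coord M i q" using \<open>x \<in> V\<close> unfolding V_def by blast
    then have "q \<in> U" and fq: "f q \<in> chart_dom N1 j \<times> chart_dom N2 k" unfolding A_def by auto
    then have "f q \<in> B" using q(1) fi_f(1)[OF \<open>q \<in> U\<close>] unfolding A_def B_def by auto
    have Fx: "F x = coord ?N (j, k) (f q)" using F_eq q by simp
    then have "F x \<in> W" using \<open>f q \<in> B\<close> unfolding W_def by blast
    have GF: "G (F x) = x" using Fx G_eq[OF \<open>f q \<in> B\<close>] fi_f(1)[OF \<open>q \<in> U\<close>] q(2) by simp
    show "fst (F x) \<in> chart_image N1 j" "snd (F x) \<in> chart_image N2 k"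
      using fq unfolding Fx n(3)[OF fq] chart_image_def by auto
    have "surj (dd F (G (F x)))"
      by (rule surj_derivative_if_right_inverse[OF twice_differentiable_onD(1)[OF G \<open>F x \<in> W\<close>]
            _ \<open>open W\<close> \<open>F x \<in> W\<close> FG])
        (simp add: GF twice_differentiable_onD(1)[OF F that])
    then show "surj (dd F x)" by (simp only: GF)
  qed
  note fstF = twice_differentiable_on_bounded_linear[OF bounded_linear_fst \<open>open V\<close> F]
  note sndF = twice_differentiable_on_bounded_linear[OF bounded_linear_snd \<open>open V\<close> F]
  show thesis
  proof (rule that[OF i(1) jk(1,2) \<open>open V\<close> _ _ fstF(1) _ sndF(1)])
    show "V \<subseteq> chart_image M i" unfolding V_def A_def chart_image_def by blast
    show "coord M i p \<in> V" using i(2) jk(3) U(2) unfolding V_def A_def by blast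
    show "(\<lambda>x. fst (F x)) ` V \<subseteq> chart_image N1 j" "(\<lambda>x. snd (F x)) ` V \<subseteq> chart_image N2 k"
      using F_in by auto
    show "g i x v w = pullback (h1 j) (\<lambda>x. fst (F x)) x v w + pullback (h2 k) (\<lambda>x. snd (F x)) x v w"
      if "x \<in> V" for x v w
      using met[OF idx that[unfolded V], of v w, folded F_def]
      by (simp add: pullback_def product_metric_def case_prod_beta fstF(2)[OF that] sndF(2)[OF that])
    show "surj (\<lambda>v. (dd (\<lambda>x. fst (F x)) x v, dd (\<lambda>x. snd (F x)) x v))" if "x \<in> V" for x
      using surjF[OF that] by (simp add: fstF(2)[OF that] sndF(2)[OF that])
  qed
qed

context maximal_jacobi_rank
begin

text \<open>
  Near a point where the manifold splits, the metric of the first factor, pulled back, is a parallel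
  form.  Being proportional to the metric by the rank condition, it would have to be zero or
  nondegenerate, and it is neither.
\<close>

lemma locally_irreducible_metric:
  "locally_irreducible TYPE(('j, 'n::{t2_space, second_countable_topology}, 'c::euclidean_space) atlas)
     TYPE(('k, 'p::{t2_space, second_countable_topology}, 'd::euclidean_space) atlas) M g"
proof -
  have False
    if U: "open U" "p \<in> U" "U \<subseteq> points M"
      and N1: "smooth_manifold N1" "pseudo_riemannian_metric N1 h1"
      and N2: "smooth_manifold N2" "pseudo_riemannian_metric N2 h2"
      and iso: "isometry (open_submanifold M U) g (product_manifold N1 N2) (product_metric h1 h2) f"
    for p U f and N1 :: "('j, 'n, 'c) atlas" and h1 and N2 :: "('k, 'p, 'd) atlas" and h2
  proof -
    obtain i j k V P Q x where i: "i \<in> idx M" "j \<in> idx N1" "k \<in> idx N2"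
      and V: "open V" "V \<subseteq> chart_image M i" "x \<in> V"
      and P: "twice_differentiable_on P V" "P ` V \<subseteq> chart_image N1 j"
      and Q: "twice_differentiable_on Q V" "Q ` V \<subseteq> chart_image N2 k"
      and split: "\<And>x v w. x \<in> V \<Longrightarrow> g i x v w = pullback (h1 j) P x v w + pullback (h2 k) Q x v w"
      and surj: "\<And>x. x \<in> V \<Longrightarrow> surj (\<lambda>v. (dd P x v, dd Q x v))"
      by (rule isometry_chart_splitting[OF manifold N1(1) N2(1) U iso]) (rule that)
    interpret metric_on V "g i"
      by (rule metric_on_subset[OF metric_on_chart[OF manifold metric i(1)] V(1,2)])
    interpret h1: metric_on "chart_image N1 j" "h1 j" by (rule metric_on_chart[OF N1 i(2)])
    interpret h2: metric_on "chart_image N2 k" "h2 k" by (rule metric_on_chart[OF N2 i(3)])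
    have "parallel_form (pullback (h1 j) P)"
      by (rule parallel_form_pullback[OF h1.metric_on_axioms h2.metric_on_axioms P Q split surj])
    note proportional = parallel_form_proportional[OF i(1) V this]
    show False
      by (rule pullback_not_proportional[OF V(3) h1.g_bilinear h2.g_bilinear split[OF V(3)] surj[OF V(3)]
            linear_dd[OF twice_differentiable_onD(1)[OF P(1) V(3)]]
            linear_dd[OF twice_differentiable_onD(1)[OF Q(1) V(3)]] proportional])
        (use P(2) Q(2) V(3) in auto)
  qed
  then show ?thesis unfolding locally_irreducible_def by blast
qed

end

theorem proposition1:
  fixes M :: "('i, 'm::{t2_space, second_countable_topology}, 'b::euclidean_space) atlas"
    and \<phi> :: "('i, 'b) tensor11"
    and \<xi> :: "('i, 'b) vector_field"
    and \<eta> :: "('i, 'b) one_form"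
    and g :: "('i, 'b) tensor02"
    and \<epsilon> :: real
    and n :: nat
  assumes "almost_para_contact_metric M \<epsilon> \<phi> \<xi> \<eta> g"
    and "connected (points M)"
    and "DIM('b) = 2 * n + 1"
    and "\<And>i x. i \<in> idx M \<Longrightarrow> x \<in> chart_image M i \<Longrightarrow> jacobi_rank M g \<xi> i x = 2 * n"
  shows "(\<forall>\<alpha>. symmetric_tensor M \<alpha> \<longrightarrow>
            (\<exists>i\<in>idx M. \<exists>x\<in>chart_image M i. \<exists>v w. \<alpha> i x v w \<noteq> 0) \<longrightarrow>
            parallel M g \<alpha> \<longrightarrow>
            (\<exists>c::real. c \<noteq> 0 \<and>
               (\<forall>i\<in>idx M. \<forall>x\<in>chart_image M i. \<forall>v w. \<alpha> i x v w = c * g i x v w))) \<and>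
         locally_irreducible TYPE(('j, 'n::{t2_space, second_countable_topology}, 'c::euclidean_space) atlas)
           TYPE(('k, 'p::{t2_space, second_countable_topology}, 'd::euclidean_space) atlas) M g"
proof -
  interpret maximal_jacobi_rank M \<xi> g
  proof
    show "smooth_manifold M" "pseudo_riemannian_metric M g" "vector_field M \<xi>"
      using assms(1) unfolding almost_para_contact_metric_def by auto
  qed (use characteristic_field_unit[OF assms(1)] assms(3,4) in auto)
  show ?thesis
  proof (intro conjI allI impI)
    fix \<alpha> assume \<alpha>: "symmetric_tensor M \<alpha>" "parallel M g \<alpha>"
      and nonzero: "\<exists>i\<in>idx M. \<exists>x\<in>chart_image M i. \<exists>v w. \<alpha> i x v w \<noteq> 0"
    obtain c where c: "\<forall>i\<in>idx M. \<forall>x\<in>chart_image M i. \<forall>v w. \<alpha> i x v w = c * g i x v w"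
      using parallel_tensor_proportional[OF assms(2) \<alpha>] by blast
    with nonzero have "c \<noteq> 0" by auto
    with c show "\<exists>c::real. c \<noteq> 0 \<and>
        (\<forall>i\<in>idx M. \<forall>x\<in>chart_image M i. \<forall>v w. \<alpha> i x v w = c * g i x v w)" by blast
  qed (rule locally_irreducible_metric)
qed

end
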